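(* Let $A=\mathrm{diag}(a_0,a_1,a_2)$ with either $0<a_0<a_1<a_2$ (collared case) or $a_1<0<a_0<a_2$ (transverse case). Consider a light-like billiard trajectory in the collared or transverse $\mathcal H$-ellipse. The trajectory is $2m$-periodic, for $2m\ge4$, if and only if $$\det\begin{pmatrix} E_3 & E_4 & \cdots & E_{m+1} \\ E_4 & E_5 & \cdots & E_{m+2} \\ \vdots & \vdots & & \vdots \\ E_{m+1} & E_{m+2} & \cdots & E_{2m-1} \end{pmatrix}=0,$$ where $$\sqrt{\delta(X-a_0)(X-a_1)(X-a_2)}=E_0+E_1X+E_2X^2+\cdots$$ is the Taylor expansion around $X=0$ and $\delta=\mathrm{sgn}(a_1)$.
   Context: $\mathbf M^3$ is $\mathbb R^3$ with coordinates $(x_0,x_1,x_2)$ and the form $\langle x,y\rangle=-x_0y_0+x_1y_1+x_2y_2$; $\mathcal H=\{x:\langle x,x\rangle=1\}$ with the restricted Lorentz metric. Geodesics of $\mathcal H$ are (connected components of) intersections of $\mathcal H$ with planes through the origin; light-like geodesics (tangent vectors $v$ with $\langle v,v\rangle=0$) are the straight-line generatrices of $\mathcal H$. The cone $\langle A^{-1}x,x\rangle=-\frac{x_0^2}{a_0}+\frac{x_1^2}{a_1}+\frac{x_2^2}{a_2}=0$ cuts $\mathcal H$ in boundary curves. In the collared case they are two closed curves, the collared $\mathcal H$-ellipse, bounding the compact domain $\{x\in\mathcal H:\langle A^{-1}x,x\rangle\ge0\}$. In the transverse case they form the transverse $\mathcal H$-ellipse; of the two compact domains one takes $\{x\in\mathcal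 H:\langle A^{-1}x,x\rangle\ge0,\ x_2>0\}$. Billiard: the particle moves along geodesic arcs of $\mathcal H$ inside the domain; on hitting the boundary at $p$ with velocity $v\in T_p\mathcal H$, its velocity becomes $v-2\frac{\langle v,n\rangle}{\langle n,n\rangle}n$, where $n=A^{-1}p\in T_p\mathcal H$ is normal to the boundary curve. The type of the geodesic is preserved; on a light-like trajectory each reflection switches between the two families of generatrices. At the four points of the transverse $\mathcal H$-ellipse with light-like tangent the reflection is counted twice (limit of two consecutive reflections, the particle returning along the incoming segment). A trajectory is $n$-periodic if it closes after $n$ reflections. The square root is any branch near $X=0$, possibly complex-valued. *)

theory Defs
  imports
    "HOL-Complex_Analysis.Complex_Analysis"
    "Jordan_Normal_Form.Determinant"
begin

no_notation vec_index (infixl \<open>$\<close> 100)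

section \<open>Minkowski space and the hyperboloid\<close>

text \<open>
  Points of Minkowski space are of type \<^typ>\<open>real^3\<close>, and the coordinates
  $(x_0, x_1, x_2)$ are \<open>x $ 0, x $ 1, x $ 2\<close>. In the three-element index
  type \<open>3\<close> the numeral \<open>3\<close> equals \<open>0\<close>, so library facts that enumerate the
  indices as \<open>1, 2, 3\<close> list the time coordinate last.
\<close>

definition lorentz :: "real^3 \<Rightarrow> real^3 \<Rightarrow> real" where
  "lorentz x y = - (x $ 0 * y $ 0) + x $ 1 * y $ 1 + x $ 2 * y $ 2"

definition hyperboloid :: "(real^3) set" where
  "hyperboloid = {x. lorentz x x = 1}"

definition tangent_space :: "real^3 \<Rightarrow> (real^3) set" where
  "tangent_space p = {v. lorentz v p = 0}"

definition light_like :: "real^3 \<Rightarrow> bool" where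
  "light_like v \<longleftrightarrow> v \<noteq> 0 \<and> lorentz v v = 0"

text \<open>The light-like geodesic through \<open>p\<close> with velocity \<open>v\<close> is the straight line \<open>p + t v\<close>.\<close>

lemma light_like_line_in_hyperboloid:
  assumes "p \<in> hyperboloid" "v \<in> tangent_space p" "light_like v"
  shows "p + t *\<^sub>R v \<in> hyperboloid"
proof -
  have "lorentz (p + t *\<^sub>R v) (p + t *\<^sub>R v) = lorentz p p + 2 * t * lorentz v p + t\<^sup>2 * lorentz v v"
    by (simp add: lorentz_def algebra_simps power2_eq_square)
  with assms show ?thesis
    by (simp add: hyperboloid_def tangent_space_def light_like_def)
qed


section \<open>The domains bounded by the ellipses\<close>

definition diag3 :: "real \<Rightarrow> real \<Rightarrow> real \<Rightarrow> real^3^3" where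
  "diag3 a0 a1 a2 = (\<chi> i j. if i = j then (if i = 0 then a0 else if i = 1 then a1 else a2) else 0)"

definition normal_vec :: "real^3^3 \<Rightarrow> real^3 \<Rightarrow> real^3" where
  "normal_vec A x = matrix_inv A *v x"

definition collared_domain :: "real^3^3 \<Rightarrow> (real^3) set" where
  "collared_domain A = {x \<in> hyperboloid. lorentz (normal_vec A x) x \<ge> 0}"

definition transverse_domain :: "real^3^3 \<Rightarrow> (real^3) set" where
  "transverse_domain A = {x \<in> hyperboloid. lorentz (normal_vec A x) x \<ge> 0 \<and> x $ 2 > 0}"

definition boundary_curve :: "real^3^3 \<Rightarrow> (real^3) set \<Rightarrow> (real^3) set" where
  "boundary_curve A D = {x \<in> D. lorentz (normal_vec A x) x = 0}"

lemma normal_vec_diag3: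
  assumes "a0 \<noteq> 0" "a1 \<noteq> 0" "a2 \<noteq> 0"
  shows "normal_vec (diag3 a0 a1 a2) x $ 0 = x $ 0 / a0"
    and "normal_vec (diag3 a0 a1 a2) x $ 1 = x $ 1 / a1"
    and "normal_vec (diag3 a0 a1 a2) x $ 2 = x $ 2 / a2"
proof -
  let ?A = "diag3 a0 a1 a2" and ?B = "diag3 (1/a0) (1/a1) (1/a2)"
  have AB: "?A ** ?B = Finite_Cartesian_Product.mat 1" "?B ** ?A = Finite_Cartesian_Product.mat 1"
    using assms
    by (auto simp: Finite_Cartesian_Product.vec_eq_iff diag3_def matrix_matrix_mult_def Finite_Cartesian_Product.mat_def
        sum_3 forall_3)
  have "matrix_inv ?A = ?B"
  proof -
    have "\<exists>M. ?A ** M = Finite_Cartesian_Product.mat 1 \<and> M ** ?A = Finite_Cartesian_Product.mat 1"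
      using AB by blast
    then have "matrix_inv ?A ** ?A = Finite_Cartesian_Product.mat 1"
      unfolding matrix_inv_def by (rule someI2_ex) simp
    then show ?thesis
      by (metis AB(1) matrix_mul_assoc matrix_mul_lid matrix_mul_rid)
  qed
  moreover have "x $ 3 = x $ 0" by (rule arg_cong[where f = "vec_nth x"]) simp
  ultimately show "normal_vec ?A x $ 0 = x $ 0 / a0" "normal_vec ?A x $ 1 = x $ 1 / a1"
      "normal_vec ?A x $ 2 = x $ 2 / a2"
    by (simp_all add: normal_vec_def diag3_def matrix_vector_mult_def sum_3)
qed


section \<open>Light-like billiard\<close>

text \<open>
  The tangent line of the boundary at \<open>p\<close> consists of the vectors of the tangent
  plane of the hyperboloid that are orthogonal to \<open>normal_vec A p\<close>.
\<close>

definition light_like_tangent :: "real^3^3 \<Rightarrow> real^3 \<Rightarrow> bool" where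
  "light_like_tangent A p \<longleftrightarrow>
     (\<exists>w \<in> tangent_space p. light_like w \<and> lorentz w (normal_vec A p) = 0)"

text \<open>
  At a point with light-like tangent the normal vector is itself light-like, and the
  reflection formula is undefined; the particle returns along the incoming segment,
  and this counts as two reflections.
\<close>

definition reflect :: "real^3^3 \<Rightarrow> real^3 \<Rightarrow> real^3 \<Rightarrow> real^3" where
  "reflect A p v =
     (if light_like_tangent A p then - v
      else let n = normal_vec A p in v - (2 * lorentz v n / lorentz n n) *\<^sub>R n)"

definition reflection_count :: "real^3^3 \<Rightarrow> real^3 \<Rightarrow> nat" where
  "reflection_count A p = (if light_like_tangent A p then 2 else 1)"

text \<open>
  \<open>p k\<close> are the consecutive points where the particle meets the boundary, and \<open>v k\<close> is
  its velocity as it leaves \<open>p k\<close>. The starting point \<open>p 0\<close> is taken on the boundary.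
\<close>

definition light_like_trajectory ::
    "real^3^3 \<Rightarrow> (real^3) set \<Rightarrow> (nat \<Rightarrow> real^3) \<Rightarrow> (nat \<Rightarrow> real^3) \<Rightarrow> bool" where
  "light_like_trajectory A D p v \<longleftrightarrow>
     (\<forall>k. p k \<in> boundary_curve A D \<and> v k \<in> tangent_space (p k) \<and> light_like (v k) \<and>
          (\<exists>t>0. p (Suc k) = p k + t *\<^sub>R v k \<and>
                 (\<forall>s\<in>{0<..<t}. p k + s *\<^sub>R v k \<in> D - boundary_curve A D)) \<and>
          v (Suc k) = reflect A (p (Suc k)) (v k))"

text \<open>
  The trajectory closes after \<open>n\<close> reflections, counted with multiplicity; \<open>n\<close> need not
  be the least such number. The \<open>N\<close> counted impacts are those at \<open>p 1, \<dots>, p N\<close>.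
\<close>

definition periodic_trajectory ::
    "real^3^3 \<Rightarrow> (nat \<Rightarrow> real^3) \<Rightarrow> (nat \<Rightarrow> real^3) \<Rightarrow> nat \<Rightarrow> bool" where
  "periodic_trajectory A p v n \<longleftrightarrow>
     (\<exists>N>0. p N = p 0 \<and> v N = v 0 \<and> (\<Sum>k=1..N. reflection_count A (p k)) = n)"

end

theory Submission
  imports Defs
begin

text \<open>
  Light-like geodesics are the lines of the two rulings of the quadric \<open>\<langle>x, x\<rangle> = 1\<close>, so the particle
  runs along lines of alternating rulings from point to point of the curve
  \<open>C = {\<langle>x, x\<rangle> = 1, \<langle>A\<inverse>x, x\<rangle> = 0}\<close>. In coordinates \<open>(s, t)\<close> that label the lines of the two
  rulings, \<open>C\<close> has bidegree \<open>(2, 2)\<close>; a flight keeps one coordinate and exchanges the two roots of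
  the equation in the other one. Two consecutive flights therefore act as a translation of the
  elliptic curve \<open>C\<close>, the trajectory closes after \<open>m\<close> such pairs iff \<open>m\<close> times the translation is
  zero, and the determinant is the classical condition of Cayley for that. Where a line of one ruling
  touches \<open>C\<close>, the two roots coincide: algebraically there is a flight along this line that stays at the
  point, which is why the reflection at such a point counts twice (\<open>trajectory_chord_path\<close>).

  The group law is replaced by explicit functions. Fix an auxiliary point \<open>q\<close> of \<open>C\<close>. The tangent
  planes at \<open>q\<close> of the quadrics \<open>X \<langle>A\<inverse>x, x\<rangle> = \<langle>x, x\<rangle> - 1\<close> sweep out \<open>C\<close> and define a function
  \<open>X(p) = (\<langle>q, p\<rangle> - 1) / \<langle>A\<inverse>q, p\<rangle>\<close> of degree two that identifies \<open>C\<close> with the curve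
  \<open>y\<^sup>2 = (1 - X/a0) (1 - X/a1) (1 - X/a2)\<close>; two flights become the translation by the difference of
  the two points over \<open>X = 0\<close>. With \<open>z = -1/X\<close>, and with \<open>z\<^sub>k\<close> the value of \<open>z\<close> after \<open>k\<close> pairs of
  flights, there are quadratic polynomials \<open>p\<^sub>k\<close> with \<open>p\<^sub>k(0) = 1\<close> and
  \<open>(p\<^sub>k - y) (p\<^sub>k + y) = \<mu>\<^sub>k X\<^sup>2 (1 + z\<^sub>k X) (1 + z\<^sub>k\<^sub>+\<^sub>1 X)\<close> (\<open>double_step_identities\<close>,
  \<open>norm_identity\<close>); this is one step of a continued fraction of \<open>y\<close>.

  Write \<open>(1 + z\<^sub>0 X) \<Prod> (p\<^sub>k - y) / (1 + z\<^sub>k X)\<close>, the product over \<open>k < m\<close>, as \<open>U + V y\<close>. Here \<open>U\<close>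
  and \<open>V\<close> are polynomials of degrees at most \<open>m + 1\<close> and \<open>m - 1\<close>, the function \<open>U + V y\<close> vanishes
  to order \<open>2 m\<close> at \<open>X = 0\<close>, \<open>y = 1\<close>, and its norm \<open>U\<^sup>2 - y\<^sup>2 V\<^sup>2\<close> is a constant times
  \<open>X\<^bsup>2m\<^esup> (1 + z\<^sub>0 X) (1 + z\<^sub>m X)\<close>. If the path closes, \<open>1 + z\<^sub>0 X\<close> divides \<open>U\<close> and \<open>V\<close>, and the quotients
  \<open>C\<close>, \<open>B\<close> have degrees at most \<open>m\<close> and \<open>m - 2\<close> and satisfy \<open>C + B y = O(X\<^bsup>2m\<^esup>)\<close>
  (\<open>closed_imp_approximant\<close>). For \<open>B \<noteq> 0\<close> this amounts to a nonzero solution of the linear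
  system with the Hankel matrix (\<open>hankel_det_eq_0_iff\<close>). Conversely, for such \<open>B\<close> and \<open>C\<close> the product
  \<open>(U + V y) (C - B y)\<close> vanishes to order \<open>2 m\<close> on both branches; for degree reasons it is \<open>X\<^bsup>2m\<^esup>\<close> times a
  linear polynomial, so that \<open>(1 + z\<^sub>0 X) (1 + z\<^sub>m X)\<close> is a square up to a constant factor, and
  \<open>z\<^sub>m = z\<^sub>0\<close> (\<open>approximant_imp_closed\<close>). All degenerate positions, and the possibility that \<open>z\<close> agrees
  at two different end points, are avoided by choosing \<open>q\<close> generically
  (\<open>boundary_generic_point\<close>); the polynomial under the root does not depend on this choice.

  Reflections preserve \<open>\<langle>A\<inverse>p, v\<rangle>\<close> (\<open>joachimsthal\<close>). Hence not only the direction but also the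
  length of the velocity is restored when the particle returns to the initial point along a line of
  the initial ruling.
\<close>

section \<open>Hankel determinants and rational approximation\<close>

lemma fps_X_power_dvd_iff:
  fixes f :: "'a::comm_ring_1 fps"
  shows "fps_X ^ n dvd f \<longleftrightarrow> (\<forall>i<n. fps_nth f i = 0)"
proof
  assume "fps_X ^ n dvd f"
  then show "\<forall>i<n. fps_nth f i = 0"
    by (auto simp: dvd_def fps_X_power_mult_nth)
next
  assume *: "\<forall>i<n. fps_nth f i = 0"
  have "f = fps_X ^ n * fps_shift n f"
    by (rule fps_ext) (use * in \<open>auto simp: fps_X_power_mult_nth\<close>)
  then show "fps_X ^ n dvd f"
    by (metis dvd_triv_left)
qed

lemma fps_X_power_dvd_fps_of_poly_imp_0:
  assumes "fps_X ^ n dvd fps_of_poly p" "degree p < n"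
  shows "p = (0::'a::comm_ring_1 poly)"
proof (rule poly_eqI)
  fix i show "coeff p i = coeff 0 i"
    using assms by (cases "i < n") (auto simp: fps_X_power_dvd_iff coeff_eq_0)
qed

lemma det_eq_0_iff_kernel:
  fixes h :: "nat \<Rightarrow> nat \<Rightarrow> 'a::field"
  shows "Determinant.det (Matrix.mat n n (\<lambda>(i, j). h i j)) = 0 \<longleftrightarrow>
    (\<exists>x. (\<exists>j<n. x j \<noteq> 0) \<and> (\<forall>i<n. (\<Sum>j<n. h i j * x j) = 0))" (is "?L \<longleftrightarrow> ?R")
proof -
  define H where "H = Matrix.mat n n (\<lambda>(i, j). h i j)"
  have H: "H \<in> carrier_mat n n" by (simp add: H_def)
  have mult: "H *\<^sub>v v = 0\<^sub>v n \<longleftrightarrow> (\<forall>i<n. (\<Sum>j<n. h i j * vec_index v j) = 0)"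
    if "v \<in> carrier_vec n" for v
    using that by (auto simp: H_def Matrix.vec_eq_iff scalar_prod_def atLeast0LessThan)
  have "?L \<longleftrightarrow> (\<exists>v. v \<in> carrier_vec n \<and> v \<noteq> 0\<^sub>v n \<and> H *\<^sub>v v = 0\<^sub>v n)"
    unfolding H_def[symmetric] by (rule det_0_iff_vec_prod_zero[OF H])
  also have "\<dots> \<longleftrightarrow> ?R"
  proof
    assume "\<exists>v. v \<in> carrier_vec n \<and> v \<noteq> 0\<^sub>v n \<and> H *\<^sub>v v = 0\<^sub>v n"
    then obtain v where v: "v \<in> carrier_vec n" "v \<noteq> 0\<^sub>v n" "H *\<^sub>v v = 0\<^sub>v n" by blast
    then show ?R
      using mult[of v] by (intro exI[of _ "vec_index v"]) (auto simp: Matrix.vec_eq_iff)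
  next
    assume ?R
    then obtain x where x: "\<exists>j<n. x j \<noteq> 0" "\<forall>i<n. (\<Sum>j<n. h i j * x j) = 0" by blast
    have "Matrix.vec n x \<noteq> 0\<^sub>v n" using x(1) by (auto simp: Matrix.vec_eq_iff)
    moreover have "H *\<^sub>v Matrix.vec n x = 0\<^sub>v n" using x(2) by (subst mult) simp_all
    ultimately show "\<exists>v. v \<in> carrier_vec n \<and> v \<noteq> 0\<^sub>v n \<and> H *\<^sub>v v = 0\<^sub>v n"
      by (intro exI[of _ "Matrix.vec n x"]) simp
  qed
  finally show ?thesis .
qed

text \<open>
  The coefficients of \<open>B y\<close> in degrees \<open>m + 1, \<dots>, 2 m - 1\<close> have to
  vanish, and those in lower degrees can be cancelled by \<open>C\<close>. So a vector in the kernel of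
  the Hankel matrix is the reversed coefficient list of \<open>B\<close>.
\<close>

lemma hankel_det_eq_0_iff:
  fixes y :: "'a::field fps"
  assumes "m \<ge> 2"
  shows "Determinant.det (Matrix.mat (m - 1) (m - 1) (\<lambda>(i, j). fps_nth y (i + j + 3))) = 0 \<longleftrightarrow>
    (\<exists>B C. B \<noteq> 0 \<and> degree B \<le> m - 2 \<and> degree C \<le> m \<and>
       fps_X ^ (2 * m) dvd fps_of_poly C + fps_of_poly B * y)" (is "?L \<longleftrightarrow> ?R")
proof -
  have conv: "fps_nth (fps_of_poly B * y) (m + 1 + i) = (\<Sum>l<m - 1. fps_nth y (i + l + 3) * coeff B (m - 2 - l))"
    if "degree B \<le> m - 2" for B i
  proof -
    have "fps_nth (fps_of_poly B * y) (m + 1 + i) = (\<Sum>j=0..m + 1 + i. coeff B j * fps_nth y (m + 1 + i - j))"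
      by (simp add: fps_mult_nth)
    also have "\<dots> = (\<Sum>j<m - 1. coeff B j * fps_nth y (m + 1 + i - j))"
      by (rule sum.mono_neutral_right) (use that assms in \<open>auto intro!: coeff_eq_0\<close>)
    also have "\<dots> = (\<Sum>l<m - 1. fps_nth y (i + l + 3) * coeff B (m - 2 - l))"
    proof (rule sum.reindex_bij_witness[of _ "\<lambda>l. m - 2 - l" "\<lambda>l. m - 2 - l"])
      fix j assume "j \<in> {..<m - 1}"
      then have "i + (m - 2 - j) + 3 = m + 1 + i - j" "m - 2 - (m - 2 - j) = j" by auto
      then show "fps_nth y (i + (m - 2 - j) + 3) * coeff B (m - 2 - (m - 2 - j)) = coeff B j * fps_nth y (m + 1 + i - j)"
        by (simp only: mult.commute)
    qed (use assms in auto)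
    finally show ?thesis .
  qed
  have "?L \<longleftrightarrow> (\<exists>x. (\<exists>j<m - 1. x j \<noteq> 0) \<and> (\<forall>i<m - 1. (\<Sum>j<m - 1. fps_nth y (i + j + 3) * x j) = 0))"
    (is "_ \<longleftrightarrow> ?K")
    by (rule det_eq_0_iff_kernel)
  also have "?K \<longleftrightarrow> ?R"
  proof
    assume ?K
    then obtain x j0 where x: "j0 < m - 1" "x j0 \<noteq> 0"
      "\<And>i. i < m - 1 \<Longrightarrow> (\<Sum>j<m - 1. fps_nth y (i + j + 3) * x j) = 0" by blast
    define B where "B = (\<Sum>j\<le>m - 2. Polynomial.monom (x (m - 2 - j)) j)"
    have cB: "coeff B j = (if j \<le> m - 2 then x (m - 2 - j) else 0)" for j
      by (simp add: B_def coeff_sum)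
    have degB: "degree B \<le> m - 2"
      by (rule degree_le) (simp add: cB)
    have "m - 2 - (m - 2 - j0) = j0" "m - 2 - j0 \<le> m - 2" using x(1) by auto
    then have "coeff B (m - 2 - j0) \<noteq> 0"
      unfolding cB by (simp only: if_True x(2) not_False_eq_True)
    then have "B \<noteq> 0" by auto
    define C where "C = - truncate_fps (m + 1) (fps_of_poly B * y)"
    have "degree C < m + 1"
      unfolding C_def degree_minus by (rule degree_truncate_fps) simp
    have "fps_nth (fps_of_poly C + fps_of_poly B * y) n = 0" if "n < 2 * m" for n
    proof (cases "n < m + 1")
      case False
      then obtain i where i: "n = m + 1 + i" by (metis le_Suc_ex not_le)
      have "(\<Sum>l<m - 1. fps_nth y (i + l + 3) * coeff B (m - 2 - l)) = (\<Sum>l<m - 1. fps_nth y (i + l + 3) * x l)"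
      proof (rule sum.cong)
        fix l assume "l \<in> {..<m - 1}"
        then have "m - 2 - (m - 2 - l) = l" "m - 2 - l \<le> m - 2" by auto
        then show "fps_nth y (i + l + 3) * coeff B (m - 2 - l) = fps_nth y (i + l + 3) * x l"
          unfolding cB by (simp only: if_True)
      qed simp
      with x(3)[of i] i that conv[OF degB, of i] show ?thesis
        by (simp add: C_def coeff_truncate_fps)
    qed (simp add: C_def coeff_truncate_fps)
    with \<open>B \<noteq> 0\<close> degB \<open>degree C < m + 1\<close> show ?R
      by (intro exI[of _ B] exI[of _ C]) (auto simp: fps_X_power_dvd_iff)
  next
    assume ?R
    then obtain B C where BC: "B \<noteq> 0" "degree B \<le> m - 2" "degree C \<le> m"
      "\<And>n. n < 2 * m \<Longrightarrow> fps_nth (fps_of_poly C + fps_of_poly B * y) n = 0"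
      unfolding fps_X_power_dvd_iff by blast
    show ?K
    proof (intro exI[of _ "\<lambda>l. coeff B (m - 2 - l)"] conjI allI impI)
      have "m - 2 - (m - 2 - degree B) = degree B" using BC(2) by simp
      then have "coeff B (m - 2 - (m - 2 - degree B)) \<noteq> 0" using BC(1) by simp
      then show "\<exists>j<m - 1. coeff B (m - 2 - j) \<noteq> 0"
        using assms by (intro exI[of _ "m - 2 - degree B"]) auto
      fix i assume "i < m - 1"
      then have "fps_nth (fps_of_poly C + fps_of_poly B * y) (m + 1 + i) = 0" by (intro BC(4)) simp
      moreover have "coeff C (m + 1 + i) = 0" using BC(3) by (intro coeff_eq_0) simp
      ultimately show "(\<Sum>j<m - 1. fps_nth y (i + j + 3) * coeff B (m - 2 - j)) = 0"
        using conv[OF BC(2), of i] by simp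
    qed
  qed
  finally show ?thesis .
qed

section \<open>The continued fraction of the square root of a cubic\<close>

lemma odd_degree_not_square:
  fixes F :: "'a::idom poly"
  assumes "odd (degree F)" "C\<^sup>2 = F * B\<^sup>2"
  shows "B = 0"
proof (rule ccontr)
  assume "B \<noteq> 0"
  moreover have "F \<noteq> 0" using assms(1) by auto
  ultimately have "degree (F * B\<^sup>2) = degree F + 2 * degree B"
    by (simp add: degree_mult_eq degree_power_eq)
  moreover have "degree (C\<^sup>2) = 2 * degree C"
    by (cases "C = 0") (simp_all add: degree_power_eq)
  ultimately show False using assms by (metis dvd_triv_left even_add)
qed

text \<open>
  The power series \<open>y\<close> is the branch of the square root of \<open>F\<close> at the point
  \<open>X = 0\<close>, \<open>y = 1\<close> of the curve \<open>y\<^sup>2 = F\<close>. The function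
  \<open>p k - y\<close> has a double zero there, and one zero over each of \<open>1 + z\<^sub>k X =
  0\<close> and \<open>1 + z\<^sub>k\<^sub>+\<^sub>1 X = 0\<close>; the condition on sums says that
  \<open>p k - y\<close> and \<open>p (Suc k) - y\<close> vanish at conjugate points over \<open>1 +
  z\<^sub>k\<^sub>+\<^sub>1 X = 0\<close>.
\<close>

locale sqrt_continued_fraction =
  fixes F :: "complex poly" and y :: "complex fps" and m :: nat
    and p a :: "nat \<Rightarrow> complex poly" and z \<mu> :: "nat \<Rightarrow> complex"
  assumes F_degree: "degree F = 3"
    and y_square: "y\<^sup>2 = fps_of_poly F" and y_0: "fps_nth y 0 = 1"
    and p_degree: "\<And>k. degree (p k) \<le> 2" and p_0: "\<And>k. coeff (p k) 0 = 1"
    and a_degree: "\<And>k. degree (a k) \<le> 1"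
    and norm_p: "\<And>k. k < m \<Longrightarrow> (p k)\<^sup>2 - F = Polynomial.smult (\<mu> k) ([:0, 1:]\<^sup>2 * [:1, z k:] * [:1, z (Suc k):])"
    and sum_p: "\<And>k. Suc k < m \<Longrightarrow> p k + p (Suc k) = [:1, z (Suc k):] * a (Suc k)"
begin

text \<open>
  \<open>U k + V k y\<close> is \<open>(1 + z\<^sub>0 X) \<Prod> (p j - y) / (1 + z\<^sub>j X)\<close>
  with the product over \<open>j < k\<close>, by \<open>UV_step\<close>. Three consecutive products
  satisfy a linear recurrence with polynomial coefficients. Taking it as the definition makes it evident
  that \<open>U k\<close> and \<open>V k\<close> are polynomials, also when some of the
  \<open>z\<^sub>j\<close> coincide.
\<close>

fun U :: "nat \<Rightarrow> complex poly" where
  "U 0 = [:1, z 0:]"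
| "U (Suc 0) = p 0"
| "U (Suc (Suc k)) = a (Suc k) * U (Suc k) - Polynomial.smult (\<mu> k) ([:0, 1:]\<^sup>2 * U k)"

fun V :: "nat \<Rightarrow> complex poly" where
  "V 0 = 0"
| "V (Suc 0) = -1"
| "V (Suc (Suc k)) = a (Suc k) * V (Suc k) - Polynomial.smult (\<mu> k) ([:0, 1:]\<^sup>2 * V k)"

text \<open>
  Otherwise \<open>F\<close> would be a square, but its degree is odd.
\<close>

lemma mu_nonzero:
  assumes "k < m" shows "\<mu> k \<noteq> 0"
proof
  assume "\<mu> k = 0"
  then have "(p k)\<^sup>2 = F * 1\<^sup>2" using norm_p[OF assms] by simp
  with odd_degree_not_square[of F "p k" 1] F_degree show False by simp
qed

text \<open>
  Multiplication by the conjugate factor \<open>p k + y\<close> undoes the step from \<open>k\<close> to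
  \<open>Suc k\<close> up to a factor that comes from the norm of \<open>p k - y\<close>. This supplies
  the term of index \<open>k\<close> in the recurrence, and it describes the end of a closed path from
  behind.
\<close>

lemma UV_descend:
  assumes "k < m"
    and U: "[:1, z k:] * U (Suc k) = p k * U k - F * V k"
    and V: "[:1, z k:] * V (Suc k) = p k * V k - U k"
  shows "p k * U (Suc k) + F * V (Suc k) = Polynomial.smult (\<mu> k) ([:0, 1:]\<^sup>2 * [:1, z (Suc k):] * U k)"
    and "U (Suc k) + p k * V (Suc k) = Polynomial.smult (\<mu> k) ([:0, 1:]\<^sup>2 * [:1, z (Suc k):] * V k)"
proof -
  have N: "(p k)\<^sup>2 - F = [:1, z k:] * Polynomial.smult (\<mu> k) ([:0, 1:]\<^sup>2 * [:1, z (Suc k):])"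
    unfolding norm_p[OF assms(1)] by (simp only: mult_smult_right mult_ac)
  have "[:1, z k:] * (p k * U (Suc k) + F * V (Suc k)) = p k * ([:1, z k:] * U (Suc k)) + F * ([:1, z k:] * V (Suc k))"
    by (simp only: algebra_simps)
  also have "\<dots> = ((p k)\<^sup>2 - F) * U k"
    unfolding U V by (simp only: algebra_simps power2_eq_square)
  also have "\<dots> = [:1, z k:] * Polynomial.smult (\<mu> k) ([:0, 1:]\<^sup>2 * [:1, z (Suc k):] * U k)"
    unfolding N by (simp only: mult_smult_right mult_smult_left mult_ac)
  finally show "p k * U (Suc k) + F * V (Suc k) = Polynomial.smult (\<mu> k) ([:0, 1:]\<^sup>2 * [:1, z (Suc k):] * U k)"
    by (metis mult_left_cancel one_neq_zero pCons_eq_0_iff)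
  have "[:1, z k:] * (U (Suc k) + p k * V (Suc k)) = [:1, z k:] * U (Suc k) + p k * ([:1, z k:] * V (Suc k))"
    by (simp only: algebra_simps)
  also have "\<dots> = ((p k)\<^sup>2 - F) * V k"
    unfolding U V by (simp only: algebra_simps power2_eq_square)
  also have "\<dots> = [:1, z k:] * Polynomial.smult (\<mu> k) ([:0, 1:]\<^sup>2 * [:1, z (Suc k):] * V k)"
    unfolding N by (simp only: mult_smult_right mult_smult_left mult_ac)
  finally show "U (Suc k) + p k * V (Suc k) = Polynomial.smult (\<mu> k) ([:0, 1:]\<^sup>2 * [:1, z (Suc k):] * V k)"
    by (metis mult_left_cancel one_neq_zero pCons_eq_0_iff)
qed

lemma UV_step:
  assumes "k < m"
  shows "[:1, z k:] * U (Suc k) = p k * U k - F * V k"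
    and "[:1, z k:] * V (Suc k) = p k * V k - U k"
proof -
  have "[:1, z k:] * U (Suc k) = p k * U k - F * V k \<and> [:1, z k:] * V (Suc k) = p k * V k - U k"
    using assms
  proof (induction k)
    case 0
    then show ?case by simp
  next
    case (Suc k)
    let ?l = "[:1, z (Suc k):]"
    have k: "k < m" using Suc.prems by simp
    have IH: "[:1, z k:] * U (Suc k) = p k * U k - F * V k" "[:1, z k:] * V (Suc k) = p k * V k - U k"
      using Suc.IH k by auto
    note desc = UV_descend[OF k IH]
    have "?l * U (Suc (Suc k)) = (?l * a (Suc k)) * U (Suc k) - Polynomial.smult (\<mu> k) ([:0, 1:]\<^sup>2 * ?l * U k)"
      unfolding U.simps(3) by (simp only: right_diff_distrib mult_smult_right mult_ac)
    also have "\<dots> = p (Suc k) * U (Suc k) - F * V (Suc k)"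
      unfolding sum_p[OF Suc.prems, symmetric] desc(1)[symmetric] by (simp only: algebra_simps)
    finally have 1: "?l * U (Suc (Suc k)) = p (Suc k) * U (Suc k) - F * V (Suc k)" .
    have "?l * V (Suc (Suc k)) = (?l * a (Suc k)) * V (Suc k) - Polynomial.smult (\<mu> k) ([:0, 1:]\<^sup>2 * ?l * V k)"
      unfolding V.simps(3) by (simp only: right_diff_distrib mult_smult_right mult_ac)
    also have "\<dots> = p (Suc k) * V (Suc k) - U (Suc k)"
      unfolding sum_p[OF Suc.prems, symmetric] desc(2)[symmetric] by (simp only: algebra_simps)
    finally show ?case using 1 by blast
  qed
  then show "[:1, z k:] * U (Suc k) = p k * U k - F * V k" "[:1, z k:] * V (Suc k) = p k * V k - U k"
    by auto
qed

text \<open>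
  The norm is multiplicative, and in the product of the norms of the factors all linear polynomials
  except the first and the last one cancel.
\<close>

lemma UV_norm:
  assumes "k \<le> m"
  shows "(U k)\<^sup>2 - F * (V k)\<^sup>2 = Polynomial.smult (\<Prod>j<k. \<mu> j) ([:0, 1:] ^ (2 * k) * [:1, z 0:] * [:1, z k:])"
  using assms
proof (induction k)
  case 0
  then show ?case by (simp add: power2_eq_square)
next
  case (Suc k)
  let ?l = "[:1, z k:]"
  have "?l\<^sup>2 * ((U (Suc k))\<^sup>2 - F * (V (Suc k))\<^sup>2) = (?l * U (Suc k))\<^sup>2 - F * (?l * V (Suc k))\<^sup>2"
    by (simp only: algebra_simps power2_eq_square)
  also have "\<dots> = ((p k)\<^sup>2 - F) * ((U k)\<^sup>2 - F * (V k)\<^sup>2)"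
    using Suc.prems by (simp only: UV_step Suc_le_eq) (simp only: algebra_simps power2_eq_square)
  also have "\<dots> = ?l\<^sup>2 * Polynomial.smult (\<Prod>j<Suc k. \<mu> j) (([:0, 1:]\<^sup>2 * [:0, 1:] ^ (2 * k)) * [:1, z 0:] * [:1, z (Suc k):])"
    using Suc.prems Suc.IH norm_p[of k]
    by (simp only: mult_smult_left mult_smult_right smult_smult prod.lessThan_Suc mult_ac
        power2_eq_square Suc_le_eq less_imp_le)
  also have "[:0, 1:]\<^sup>2 * [:0, 1:] ^ (2 * k) = ([:0, 1:] ^ (2 * Suc k) :: complex poly)"
    by (simp only: power_add[symmetric]) simp
  finally show ?case
    by (metis mult_left_cancel one_neq_zero pCons_eq_0_iff power_not_zero)
qed

lemma UV_degree: "degree (U k) \<le> k + 1" "degree (V k) \<le> k - 1"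
proof -
  have X2: "degree ([:0, 1:]\<^sup>2 * q) \<le> 2 + degree q" for q :: "complex poly"
    by (rule order.trans[OF degree_mult_le]) (simp add: degree_power_eq)
  have "degree (U k) \<le> k + 1 \<and> degree (V k) \<le> k - 1"
  proof (induction k rule: induct_nat_012)
    case 0
    show ?case by simp
  next
    case 1
    show ?case using p_degree[of 0] by simp
  next
    case (ge2 k)
    have "degree (a (Suc k) * U (Suc k)) \<le> Suc (Suc k) + 1"
      using degree_mult_le[of "a (Suc k)" "U (Suc k)"] a_degree[of "Suc k"] ge2 by simp
    moreover have "degree (Polynomial.smult (\<mu> k) ([:0, 1:]\<^sup>2 * U k)) \<le> Suc (Suc k) + 1"
      using X2[of "U k"] ge2 degree_smult_le[of "\<mu> k" "[:0, 1:]\<^sup>2 * U k"] by linarith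
    moreover have "degree (a (Suc k) * V (Suc k)) \<le> Suc (Suc k) - 1"
      using degree_mult_le[of "a (Suc k)" "V (Suc k)"] a_degree[of "Suc k"] ge2 by simp
    moreover have "degree (Polynomial.smult (\<mu> k) ([:0, 1:]\<^sup>2 * V k)) \<le> Suc (Suc k) - 1"
    proof (cases k)
      case (Suc n)
      then show ?thesis
        using X2[of "V k"] ge2 degree_smult_le[of "\<mu> k" "[:0, 1:]\<^sup>2 * V k"] by linarith
    qed simp
    ultimately show ?case by (simp add: degree_diff_le)
  qed
  then show "degree (U k) \<le> k + 1" "degree (V k) \<le> k - 1" by auto
qed

lemma y_square': "y * y = fps_of_poly F"
  using y_square by (simp add: power2_eq_square)

text \<open>
  The product with \<open>p k + y\<close> is divisible by \<open>X\<^sup>2\<close>, and \<open>p k +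
  y\<close> is a unit because its constant coefficient is \<open>2\<close>.
\<close>

lemma p_minus_y:
  assumes "k < m" shows "fps_X\<^sup>2 dvd fps_of_poly (p k) - y"
proof -
  have "(fps_of_poly (p k) - y) * (fps_of_poly (p k) + y) = fps_of_poly ((p k)\<^sup>2 - F)"
    by (simp add: algebra_simps fps_of_poly_diff power2_eq_square fps_of_poly_mult y_square')
  also have "fps_X\<^sup>2 dvd \<dots>"
    unfolding norm_p[OF assms]
    by (simp only: fps_of_poly_smult fps_of_poly_mult fps_of_poly_power fps_of_poly_fps_X mult.assoc)
      (simp only: dvd_triv_left mult.left_commute[of _ "fps_X\<^sup>2"])
  finally have "fps_X\<^sup>2 dvd (fps_of_poly (p k) - y) * (fps_of_poly (p k) + y)" .
  moreover have "fps_of_poly (p k) + y dvd 1"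
    by (simp add: p_0 y_0)
  ultimately show ?thesis by (simp add: dvd_mult_unit_iff)
qed

lemma UV_order:
  assumes "k \<le> m"
  shows "fps_X ^ (2 * k) dvd fps_of_poly (U k) + fps_of_poly (V k) * y"
  using assms
proof (induction k)
  case (Suc k)
  let ?h = "\<lambda>k. fps_of_poly (U k) + fps_of_poly (V k) * y"
  have k: "k < m" using Suc.prems by simp
  have "fps_of_poly [:1, z k:] * ?h (Suc k) =
      fps_of_poly ([:1, z k:] * U (Suc k)) + fps_of_poly ([:1, z k:] * V (Suc k)) * y"
    by (simp only: fps_of_poly_mult algebra_simps)
  also have "\<dots> = (fps_of_poly (p k) - y) * ?h k"
    unfolding UV_step[OF k] by (simp add: fps_of_poly_mult fps_of_poly_diff algebra_simps y_square'[symmetric])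
  finally have eq: "fps_of_poly [:1, z k:] * ?h (Suc k) = (fps_of_poly (p k) - y) * ?h k" .
  have "fps_X ^ (2 * Suc k) dvd (fps_of_poly (p k) - y) * ?h k"
    using mult_dvd_mono[OF p_minus_y[OF k] Suc.IH] k by (simp add: power_add power2_eq_square mult.assoc)
  moreover have "fps_of_poly [:1, z k:] dvd 1"
    by simp
  ultimately show ?case unfolding eq[symmetric] by (simp only: dvd_mult_unit_iff')
qed simp

text \<open>
  At the root \<open>x\<close> of \<open>1 + z\<^sub>0 X\<close> the recurrence starts from
  \<open>0\<close>, so it stays on the line spanned by \<open>(p 0, -1)\<close>. Since the path closes,
  the last factor has at \<open>x\<close> the value that belongs to the conjugate point, and this puts
  \<open>(U m, V m)\<close> on the line spanned by \<open>(p 0, 1)\<close>. The two lines are different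
  because \<open>(p 0)\<^sup>2 = F\<close> is not zero at \<open>x\<close>. So \<open>U m\<close> and
  \<open>V m\<close> vanish at \<open>x\<close>, and the common factor can be removed.
\<close>

lemma closed_imp_approximant:
  assumes "m \<ge> 2" "z m = z 0" "z 0 \<noteq> 0" "poly F (- 1 / z 0) \<noteq> 0"
    and closed: "[:1, z 0:] dvd p (m - 1) + p 0"
  shows "\<exists>B C. B \<noteq> 0 \<and> degree B \<le> m - 2 \<and> degree C \<le> m \<and>
       fps_X ^ (2 * m) dvd fps_of_poly C + fps_of_poly B * y"
proof -
  define x where "x = - 1 / z 0"
  have x: "x \<noteq> 0" "1 + z 0 * x = 0" using assms(3) by (simp_all add: x_def)
  have inv: "poly (U k) x + poly (p 0) x * poly (V k) x = 0" for k
  proof (induction k rule: induct_nat_012)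
    case (ge2 k)
    have "poly (U (Suc (Suc k))) x + poly (p 0) x * poly (V (Suc (Suc k))) x =
      poly (a (Suc k)) x * (poly (U (Suc k)) x + poly (p 0) x * poly (V (Suc k)) x)
      - \<mu> k * x\<^sup>2 * (poly (U k) x + poly (p 0) x * poly (V k) x)"
      by (simp add: algebra_simps)
    then show ?case using ge2 by simp
  qed (use x in \<open>simp_all add: mult.commute\<close>)
  obtain n where n: "m = Suc n" using assms(1) by (cases m) auto
  have "poly (U m + p n * V m) x = 0"
    using UV_descend(2)[OF _ UV_step, of n] n assms(2) x
    by (simp del: mult_pCons_left mult_pCons_right U.simps V.simps add: poly_mult mult.commute)
  moreover have "poly (p n) x = - poly (p 0) x"
  proof -
    obtain c where "p n + p 0 = [:1, z 0:] * c"
      using closed n by (auto elim: dvdE)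
    then have "poly (p n + p 0) x = (1 + z 0 * x) * poly c x"
      by (simp only: poly_mult) (simp add: mult.commute)
    then have "poly (p n + p 0) x = 0" using x by simp
    then show ?thesis by (simp add: eq_neg_iff_add_eq_0)
  qed
  ultimately have "2 * poly (p 0) x * poly (V m) x = 0"
    using inv[of m] by (simp add: algebra_simps)
  moreover have "(poly (p 0) x)\<^sup>2 = poly F x"
  proof -
    have "poly ((p 0)\<^sup>2 - F) x = \<mu> 0 * (x\<^sup>2 * (1 + z 0 * x) * (1 + z 1 * x))"
      using norm_p[of 0] n by (simp only: poly_smult poly_mult poly_power) (simp add: mult.commute)
    then have "poly ((p 0)\<^sup>2 - F) x = 0" using x by simp
    then show ?thesis by (simp add: poly_power)
  qed
  ultimately have "poly (V m) x = 0"
    using assms(4) by (auto simp: x_def)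
  moreover from this have "poly (U m) x = 0" using inv[of m] by simp
  ultimately obtain B C where B: "V m = [:-x, 1:] * B" and C: "U m = [:-x, 1:] * C"
    by (auto simp: poly_eq_0_iff_dvd dvd_def)
  have degB: "degree B \<le> m - 2"
  proof (cases "B = 0")
    case False
    then have "degree (V m) = 1 + degree B" unfolding B by (subst degree_mult_eq) auto
    then show ?thesis using UV_degree(2)[of m] by simp
  qed simp
  have degC: "degree C \<le> m"
  proof (cases "C = 0")
    case False
    then have "degree (U m) = 1 + degree C" unfolding C by (subst degree_mult_eq) auto
    then show ?thesis using UV_degree(1)[of m] by simp
  qed simp
  have "fps_of_poly (U m) + fps_of_poly (V m) * y = fps_of_poly [:-x, 1:] * (fps_of_poly C + fps_of_poly B * y)"
    by (simp only: B C fps_of_poly_mult algebra_simps)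
  with UV_order[of m] have "fps_X ^ (2 * m) dvd fps_of_poly [:-x, 1:] * (fps_of_poly C + fps_of_poly B * y)"
    by simp
  moreover have "fps_of_poly [:-x, 1:] dvd 1"
    using x by simp
  ultimately have dvd: "fps_X ^ (2 * m) dvd fps_of_poly C + fps_of_poly B * y"
    by (simp only: dvd_mult_unit_iff')
  have "B \<noteq> 0"
  proof
    assume "B = 0"
    with dvd have "C = 0"
      by (intro fps_X_power_dvd_fps_of_poly_imp_0[of "2 * m"]) (use degC assms(1) in auto)
    with \<open>B = 0\<close> have "(U m)\<^sup>2 - F * (V m)\<^sup>2 = 0" unfolding B C by simp
    then have "(\<Prod>j<m. \<mu> j) = 0"
      unfolding UV_norm[OF order.refl] by (simp del: mult_pCons_left mult_pCons_right)
    then show False using mu_nonzero by auto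
  qed
  with degB degC dvd show ?thesis by blast
qed

text \<open>
  The product of \<open>U m + V m y\<close> with the conjugate of \<open>C + B y\<close> vanishes to
  order \<open>2 m\<close> on both branches. The degree bounds leave no room for its
  \<open>y\<close>-part, and leave only \<open>X\<^bsup>2m\<^esup> (c + d X)\<close> for the rest. Its
  norm is a square, which forces a double root of \<open>(1 + z\<^sub>0 X) (1 + z\<^sub>m X)\<close>.
\<close>

lemma approximant_imp_closed:
  assumes "m \<ge> 2" and "B \<noteq> 0" "degree B \<le> m - 2" "degree C \<le> m"
    and dvd: "fps_X ^ (2 * m) dvd fps_of_poly C + fps_of_poly B * y"
  shows "z m = z 0"
proof -
  define N where "N = C\<^sup>2 - F * B\<^sup>2"
  have "fps_of_poly N = (fps_of_poly C + fps_of_poly B * y) * (fps_of_poly C - fps_of_poly B * y)"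
    by (simp add: N_def fps_of_poly_diff fps_of_poly_mult power2_eq_square algebra_simps y_square'[symmetric])
  with dvd have "fps_X ^ (2 * m) dvd fps_of_poly N"
    by simp
  then have N_low: "coeff N i = 0" if "i < 2 * m" for i
    using that by (simp add: fps_X_power_dvd_iff)
  have "degree (C\<^sup>2) \<le> 2 * m"
    using degree_power_le[of C 2] assms(4) by simp
  moreover have "degree (F * B\<^sup>2) \<le> 2 * m"
    using degree_mult_le[of F "B\<^sup>2"] degree_power_le[of B 2] assms(1,3) F_degree by simp
  ultimately have degN: "degree N \<le> 2 * m"
    unfolding N_def by (rule degree_diff_le)
  define \<kappa> where "\<kappa> = coeff N (2 * m)"
  have N: "N = Polynomial.smult \<kappa> ([:0, 1:] ^ (2 * m))"
  proof (rule poly_eqI)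
    fix i
    have "[:0, 1:] ^ (2 * m) = (Polynomial.monom 1 (2 * m) :: complex poly)" by (simp add: monom_altdef)
    then show "coeff N i = coeff (Polynomial.smult \<kappa> ([:0, 1:] ^ (2 * m))) i"
      using N_low[of i] degN by (cases "i < 2 * m"; cases "i = 2 * m") (auto simp: \<kappa>_def coeff_eq_0)
  qed
  have "\<kappa> \<noteq> 0"
  proof
    assume "\<kappa> = 0"
    then have "C\<^sup>2 = F * B\<^sup>2" using N by (simp add: N_def)
    with odd_degree_not_square[of F C B] F_degree assms(2) show False by simp
  qed
  define U' where "U' = U m * C - F * V m * B"
  define V' where "V' = V m * C - U m * B"
  have "fps_of_poly U' + fps_of_poly V' * y =
      (fps_of_poly (U m) + fps_of_poly (V m) * y) * (fps_of_poly C - fps_of_poly B * y)"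
    by (simp add: U'_def V'_def fps_of_poly_diff fps_of_poly_mult algebra_simps y_square'[symmetric])
  then have d1: "fps_X ^ (2 * m) dvd fps_of_poly U' + fps_of_poly V' * y"
    using UV_order[of m] by simp
  have "fps_of_poly U' - fps_of_poly V' * y =
      (fps_of_poly (U m) - fps_of_poly (V m) * y) * (fps_of_poly C + fps_of_poly B * y)"
    by (simp add: U'_def V'_def fps_of_poly_diff fps_of_poly_mult algebra_simps y_square'[symmetric])
  then have d2: "fps_X ^ (2 * m) dvd fps_of_poly U' - fps_of_poly V' * y"
    using dvd by simp
  have two: "(2 :: complex fps) dvd 1" by (simp add: fps_is_unit_iff)
  have "fps_X ^ (2 * m) dvd 2 * fps_of_poly U'"
  proof -
    have "(fps_of_poly U' + fps_of_poly V' * y) + (fps_of_poly U' - fps_of_poly V' * y) = 2 * fps_of_poly U'"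
      by (simp only: mult_2) simp
    then show ?thesis using dvd_add[OF d1 d2] by (simp only:)
  qed
  then have U'_dvd: "fps_X ^ (2 * m) dvd fps_of_poly U'"
    by (simp only: dvd_mult_unit_iff'[OF two])
  have "fps_X ^ (2 * m) dvd 2 * (fps_of_poly V' * y)"
  proof -
    have "(fps_of_poly U' + fps_of_poly V' * y) - (fps_of_poly U' - fps_of_poly V' * y) = 2 * (fps_of_poly V' * y)"
      by (simp only: mult_2) simp
    then show ?thesis using dvd_diff[OF d1 d2] by (simp only:)
  qed
  then have "fps_X ^ (2 * m) dvd fps_of_poly V' * y"
    by (simp only: dvd_mult_unit_iff'[OF two])
  then have "fps_X ^ (2 * m) dvd fps_of_poly V'"
    by (subst (asm) dvd_mult_unit_iff) (simp_all add: y_0)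
  moreover have "degree V' < 2 * m"
  proof -
    have "degree (V m * C) \<le> 2 * m - 1"
      using degree_mult_le[of "V m" C] UV_degree(2)[of m] assms(1,4) by simp
    moreover have "degree (U m * B) \<le> 2 * m - 1"
      using degree_mult_le[of "U m" B] UV_degree(1)[of m] assms(1,3) by simp
    ultimately have "degree V' \<le> 2 * m - 1"
      unfolding V'_def by (rule degree_diff_le)
    then show ?thesis using assms(1) by simp
  qed
  ultimately have V'_0: "V' = 0"
    by (rule fps_X_power_dvd_fps_of_poly_imp_0)
  have degU': "degree U' \<le> 2 * m + 1"
  proof -
    have "degree (U m * C) \<le> 2 * m + 1"
      using degree_mult_le[of "U m" C] UV_degree(1)[of m] assms(1,4) by simp
    moreover have "degree (F * V m * B) \<le> 2 * m + 1"
      using degree_mult_le[of "F * V m" B] degree_mult_le[of F "V m"] UV_degree(2)[of m] assms(1,3) F_degree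
      by simp
    ultimately show ?thesis
      unfolding U'_def by (rule degree_diff_le)
  qed
  define c d where "c = coeff U' (2 * m)" and "d = coeff U' (2 * m + 1)"
  have U': "U' = [:0, 1:] ^ (2 * m) * [:c, d:]"
  proof (rule poly_eqI)
    fix i
    have "[:0, 1:] ^ (2 * m) = (Polynomial.monom 1 (2 * m) :: complex poly)" by (simp add: monom_altdef)
    then show "coeff U' i = coeff ([:0, 1:] ^ (2 * m) * [:c, d:]) i"
      using U'_dvd degU'
      by (cases "i < 2 * m"; cases "i = 2 * m"; cases "i = 2 * m + 1")
        (auto simp: c_def d_def coeff_eq_0 coeff_monom_mult fps_X_power_dvd_iff coeff_pCons
          split: nat.splits)
  qed
  define M where "M = (\<Prod>j<m. \<mu> j) * \<kappa>"
  have "M \<noteq> 0" using mu_nonzero \<open>\<kappa> \<noteq> 0\<close> by (auto simp: M_def)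
  have "U'\<^sup>2 = U'\<^sup>2 - F * V'\<^sup>2" by (simp add: V'_0)
  also have "\<dots> = ((U m)\<^sup>2 - F * (V m)\<^sup>2) * N"
    by (simp add: U'_def V'_def N_def algebra_simps power2_eq_square)
  also have "\<dots> = ([:0, 1:] ^ (2 * m))\<^sup>2 * Polynomial.smult M ([:1, z 0:] * [:1, z m:])"
    unfolding N UV_norm[OF order.refl] 
    by (simp only: M_def power2_eq_square mult_smult_left mult_smult_right smult_smult mult_ac)
  finally have "([:0, 1:] ^ (2 * m))\<^sup>2 * [:c, d:]\<^sup>2 = ([:0, 1:] ^ (2 * m))\<^sup>2 * Polynomial.smult M ([:1, z 0:] * [:1, z m:])"
    by (simp only: U' power_mult_distrib)
  moreover have "([:0, 1:] ^ (2 * m))\<^sup>2 \<noteq> (0 :: complex poly)" by simp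
  ultimately have "[:c, d:]\<^sup>2 = Polynomial.smult M ([:1, z 0:] * [:1, z m:])"
    by (metis mult_left_cancel)
  then have *: "c * c = M" "2 * c * d = M * (z 0 + z m)" "d * d = M * (z 0 * z m)"
    by (simp_all add: power2_eq_square algebra_simps)
  have "M\<^sup>2 * ((z 0 + z m)\<^sup>2 - 4 * (z 0 * z m)) = (M * (z 0 + z m))\<^sup>2 - 4 * (M * (M * (z 0 * z m)))"
    by (simp add: power2_eq_square algebra_simps)
  also have "\<dots> = (2 * c * d)\<^sup>2 - 4 * ((c * c) * (d * d))"
    by (simp only: *)
  also have "\<dots> = 0" by (simp add: power2_eq_square)
  \<comment> \<open>the discriminant of \<open>(1 + z\<^sub>0 X) (1 + z\<^sub>m X)\<close>\<close>
  finally have "(z 0 + z m)\<^sup>2 - 4 * (z 0 * z m) = 0" using \<open>M \<noteq> 0\<close> by simp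
  then have "(z 0 - z m)\<^sup>2 = 0" by (simp add: power2_eq_square algebra_simps)
  then show ?thesis by simp
qed

end

section \<open>Minkowski geometry\<close>

no_notation fps_nth (infixl \<open>$\<close> 75)

text \<open>
  For \<open>d\<^sub>i = 1 / a\<^sub>i\<close> this is \<open>\<langle>A\<inverse>x, y\<rangle>\<close>,
  for \<open>d\<^sub>i = 1\<close> the Lorentz form, and for \<open>d\<^sub>i = 1 / a\<^sub>i -
  \<lambda>\<close> a member of the pencil that both span.
\<close>

definition diag_form :: "real \<Rightarrow> real \<Rightarrow> real \<Rightarrow> real^3 \<Rightarrow> real^3 \<Rightarrow> real" where
  "diag_form d0 d1 d2 x y = - (d0 * (x $ 0 * y $ 0)) + d1 * (x $ 1 * y $ 1) + d2 * (x $ 2 * y $ 2)"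

text \<open>
  The cross product of the Lorentz form: \<open>\<langle>lcross x y, z\<rangle>\<close> is the
  determinant of \<open>x\<close>, \<open>y\<close>, \<open>z\<close>.
\<close>

definition lcross :: "real^3 \<Rightarrow> real^3 \<Rightarrow> real^3" where
  "lcross x y = (\<chi> i. if i = 0 then - (x $ 1 * y $ 2 - x $ 2 * y $ 1)
     else if i = 1 then x $ 2 * y $ 0 - x $ 0 * y $ 2 else x $ 0 * y $ 1 - x $ 1 * y $ 0)"

text \<open>
  The light-like vectors of the tangent plane at \<open>p\<close> are eigenvectors of \<open>u \<mapsto>
  lcross p u\<close>. The eigenvalue \<open>\<epsilon> = \<plusminus>1\<close> tells which of the two
  rulings the line through \<open>p\<close> in direction \<open>u\<close> belongs to.
\<close>

definition null_direction :: "real \<Rightarrow> real^3 \<Rightarrow> real^3 \<Rightarrow> bool" where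
  "null_direction \<epsilon> p u \<longleftrightarrow> u \<noteq> 0 \<and> lcross p u = \<epsilon> *\<^sub>R u"

lemma vec3_eq_iff: "x = y \<longleftrightarrow> x $ 0 = y $ 0 \<and> x $ 1 = y $ 1 \<and> x $ 2 = y $ 2"
  for x y :: "real^3"
proof -
  have "x $ 3 = x $ 0" "y $ 3 = y $ 0" by (rule arg_cong[where f = "vec_nth _"], simp)+
  then show ?thesis by (auto simp: Finite_Cartesian_Product.vec_eq_iff forall_3)
qed

lemma lcross_nth [simp]:
  "lcross x y $ 0 = - (x $ 1 * y $ 2 - x $ 2 * y $ 1)"
  "lcross x y $ 1 = x $ 2 * y $ 0 - x $ 0 * y $ 2"
  "lcross x y $ 2 = x $ 0 * y $ 1 - x $ 1 * y $ 0"
  by (simp_all add: lcross_def)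

lemma lorentz_eq_diag_form: "lorentz = diag_form 1 1 1"
  by (simp add: fun_eq_iff lorentz_def diag_form_def)

lemma diag_form_linear [simp]:
  "diag_form d0 d1 d2 (x + y) z = diag_form d0 d1 d2 x z + diag_form d0 d1 d2 y z"
  "diag_form d0 d1 d2 z (x + y) = diag_form d0 d1 d2 z x + diag_form d0 d1 d2 z y"
  "diag_form d0 d1 d2 (x - y) z = diag_form d0 d1 d2 x z - diag_form d0 d1 d2 y z"
  "diag_form d0 d1 d2 z (x - y) = diag_form d0 d1 d2 z x - diag_form d0 d1 d2 z y"
  "diag_form d0 d1 d2 (c *\<^sub>R x) z = c * diag_form d0 d1 d2 x z"
  "diag_form d0 d1 d2 z (c *\<^sub>R x) = c * diag_form d0 d1 d2 z x"
  "diag_form d0 d1 d2 (- x) z = - diag_form d0 d1 d2 x z"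
  "diag_form d0 d1 d2 z (- x) = - diag_form d0 d1 d2 z x"
  by (simp_all add: diag_form_def algebra_simps)

lemma lorentz_linear [simp]:
  "lorentz (x + y) z = lorentz x z + lorentz y z" "lorentz z (x + y) = lorentz z x + lorentz z y"
  "lorentz (x - y) z = lorentz x z - lorentz y z" "lorentz z (x - y) = lorentz z x - lorentz z y"
  "lorentz (c *\<^sub>R x) z = c * lorentz x z" "lorentz z (c *\<^sub>R x) = c * lorentz z x"
  "lorentz (- x) z = - lorentz x z" "lorentz z (- x) = - lorentz z x"
  by (simp_all add: lorentz_eq_diag_form)

lemma diag_form_commute: "diag_form d0 d1 d2 x y = diag_form d0 d1 d2 y x"
  by (simp add: diag_form_def mult.commute)

lemma lorentz_commute: "lorentz x y = lorentz y x"
  by (simp add: lorentz_def mult.commute)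

lemma lcross_linear [simp]:
  "lcross x (y + z) = lcross x y + lcross x z" "lcross x (c *\<^sub>R y) = c *\<^sub>R lcross x y"
  "lcross (y + z) x = lcross y x + lcross z x" "lcross (c *\<^sub>R y) x = c *\<^sub>R lcross y x"
  "lcross x (- y) = - lcross x y"
  by (simp_all add: vec3_eq_iff algebra_simps)

lemma lcross_self [simp]: "lcross x x = 0"
  by (simp add: vec3_eq_iff)

lemma lorentz_lcross_self [simp]: "lorentz (lcross x y) x = 0" "lorentz (lcross x y) y = 0"
  by (simp_all add: lorentz_def algebra_simps)

lemma lorentz_lcross_cyclic: "lorentz (lcross x y) z = lorentz (lcross y z) x"
  by (simp add: lorentz_def algebra_simps)

lemma lcross_anticommute: "lcross x y = - lcross y x"
  by (simp add: vec3_eq_iff algebra_simps)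

lemma lcross_lcross: "lcross x (lcross y z) = lorentz x y *\<^sub>R z - lorentz x z *\<^sub>R y"
  by (simp add: vec3_eq_iff lorentz_def algebra_simps)

lemma lcross_expansion:
  "lorentz (lcross a b) c *\<^sub>R x =
    lorentz x a *\<^sub>R lcross b c + lorentz x b *\<^sub>R lcross c a + lorentz x c *\<^sub>R lcross a b"
  by (simp add: vec3_eq_iff lorentz_def algebra_simps)

text \<open>
  The multiplicativity of determinants, for the Gram matrix of three vectors. Applied to the whole
  pencil, it computes the discriminant of the pencil from the coefficients of the curve in a null frame.
\<close>

lemma gram_det_diag_form:
  fixes x y z :: "real^3" and d0 d1 d2 :: real
  defines "K \<equiv> diag_form d0 d1 d2"
  shows "K x x * (K y y * K z z - (K y z)\<^sup>2) - K x y * (K x y * K z z - K y z * K x z)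
      + K x z * (K x y * K y z - K y y * K x z) = - (d0 * d1 * d2) * (lorentz (lcross x y) z)\<^sup>2"
  unfolding K_def lorentz_def diag_form_def lcross_nth by Groebner_Basis.algebra

lemma null_direction_imp:
  assumes "null_direction \<epsilon> p u" "\<bar>\<epsilon>\<bar> = 1"
  shows "u \<noteq> 0" "lcross p u = \<epsilon> *\<^sub>R u" "lorentz p u = 0" "lorentz u p = 0" "lorentz u u = 0"
proof -
  have \<epsilon>: "\<epsilon> \<noteq> 0" using assms(2) by auto
  show u: "u \<noteq> 0" "lcross p u = \<epsilon> *\<^sub>R u" using assms(1) by (auto simp: null_direction_def)
  have "lorentz (\<epsilon> *\<^sub>R u) p = 0" "lorentz (\<epsilon> *\<^sub>R u) u = 0" unfolding u(2)[symmetric] by simp_all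
  then show "lorentz u p = 0" "lorentz u u = 0" "lorentz p u = 0" using \<epsilon> by (simp_all add: lorentz_commute)
qed

lemma null_zero:
  fixes x :: "real^3"
  assumes "lorentz x x = 0" "x $ 0 = 0" shows "x = 0"
proof -
  have "x $ 1 * x $ 1 + x $ 2 * x $ 2 = 0" using assms by (simp add: lorentz_def)
  then show ?thesis using assms(2) by (simp add: vec3_eq_iff sum_squares_eq_zero_iff)
qed

lemma null_direction_cases:
  assumes "lorentz p p = 1" "lorentz u p = 0" "lorentz u u = 0" "u \<noteq> 0"
  shows "null_direction 1 p u \<or> null_direction (-1) p u"
proof -
  let ?c = "lcross p u"
  have "(- (p1 * u2 - p2 * u1))\<^sup>2 = u0\<^sup>2"
    if "- (p0 * p0) + p1 * p1 + p2 * p2 = 1" "- (u0 * p0) + u1 * p1 + u2 * p2 = 0"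
      "- (u0 * u0) + u1 * u1 + u2 * u2 = 0" for p0 p1 p2 u0 u1 u2 :: real
    using that by Groebner_Basis.algebra
  from this[of "p $ 0" "p $ 1" "p $ 2" "u $ 0" "u $ 1" "u $ 2"] have "(?c $ 0)\<^sup>2 = (u $ 0)\<^sup>2"
    using assms(1-3) by (simp add: lorentz_def)
  then have "?c $ 0 = u $ 0 \<or> ?c $ 0 = - u $ 0"
    by (simp add: power2_eq_iff)
  moreover have cc: "lorentz ?c ?c = 0"
  proof -
    have "lorentz ?c ?c = lorentz (lcross u ?c) p"
      by (rule lorentz_lcross_cyclic)
    also have "lcross u ?c = 0" using assms(2,3) by (simp add: lcross_lcross)
    finally show ?thesis by (simp add: lorentz_def)
  qed
  have "?c = e *\<^sub>R u" if "?c $ 0 = e * u $ 0" for e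
  proof -
    have "?c - e *\<^sub>R u = 0"
      by (rule null_zero) (use cc assms(3) that in \<open>simp_all add: lorentz_commute[of u "lcross p u"]\<close>)
    then show ?thesis by simp
  qed
  from this[of 1] this[of "-1"] calculation assms(4) show ?thesis
    by (auto simp: null_direction_def)
qed

text \<open>
  The two vectors are orthogonal to each other, because the cross product is skew and both have the same
  eigenvalue; and two orthogonal null vectors are proportional.
\<close>

lemma null_direction_unique:
  assumes "null_direction \<epsilon> p u" "null_direction \<epsilon> p u'" "\<bar>\<epsilon>\<bar> = 1"
  obtains c where "c \<noteq> 0" "u' = c *\<^sub>R u"
proof -
  note u = null_direction_imp[OF assms(1,3)] and u' = null_direction_imp[OF assms(2,3)]
  have \<epsilon>: "\<epsilon> \<noteq> 0" using assms(3) by auto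
  have "\<epsilon> * lorentz u u' = lorentz (lcross p u) u'" by (simp add: u)
  also have "\<dots> = lorentz (lcross u' p) u" by (simp only: lorentz_lcross_cyclic)
  also have "lcross u' p = - (\<epsilon> *\<^sub>R u')" unfolding u'(2)[symmetric] by (rule lcross_anticommute)
  also have "lorentz (- (\<epsilon> *\<^sub>R u')) u = - \<epsilon> * lorentz u u'" by (simp add: lorentz_commute)
  finally have uu': "lorentz u u' = 0" "lorentz u' u = 0" using \<epsilon> by (simp_all add: lorentz_commute)
  have "u $ 0 \<noteq> 0" using null_zero[OF u(5)] u(1) by auto
  define c where "c = u' $ 0 / u $ 0"
  have "u' - c *\<^sub>R u = 0"
    by (rule null_zero) (use \<open>u $ 0 \<noteq> 0\<close> in \<open>simp_all add: u u' uu' c_def\<close>)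
  then have "u' = c *\<^sub>R u" by simp
  moreover from this have "c \<noteq> 0" using u'(1) by auto
  ultimately show thesis by (rule that[rotated])
qed

section \<open>Chords\<close>

text \<open>
  All components of the intersection of the cone with the hyperboloid, not only those in the domain of
  the particle; the auxiliary point \<open>q\<close> may lie on any of them.
\<close>

definition boundary :: "(real^3 \<Rightarrow> real^3 \<Rightarrow> real) \<Rightarrow> (real^3) set" where
  "boundary K = {p. lorentz p p = 1 \<and> K p p = 0}"

text \<open>
  The last condition says that the restriction of \<open>K\<close> to the line, a quadratic polynomial
  with root \<open>0\<close>, has \<open>\<tau>\<close> as its other root. This includes the tangent
  case \<open>\<tau> = 0\<close>, where \<open>0\<close> is a double root.
\<close>

definition chord :: "(real^3 \<Rightarrow> real^3 \<Rightarrow> real) \<Rightarrow> real \<Rightarrow> real^3 \<Rightarrow> real^3 \<Rightarrow> bool" where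
  "chord K \<epsilon> p p' \<longleftrightarrow> (\<exists>u \<tau>. null_direction \<epsilon> p u \<and> p' = p + \<tau> *\<^sub>R u \<and> 2 * K p u + \<tau> * K u u = 0)"

section \<open>Null frames\<close>

text \<open>
  With the normalization \<open>\<langle>v, w\<rangle> = 1/2\<close> the hyperboloid consists of the
  points \<open>\<alpha> q + \<beta> v + \<gamma> w\<close> with \<open>\<alpha>\<^sup>2 + \<beta>
  \<gamma> = 1\<close>.
\<close>

locale null_frame =
  fixes \<epsilon> :: real and q v w :: "real^3"
  assumes eps: "\<epsilon> * \<epsilon> = 1"
    and qq: "lorentz q q = 1" and qv: "lorentz q v = 0" and qw: "lorentz q w = 0"
    and vv: "lorentz v v = 0" and ww: "lorentz w w = 0" and vw: "lorentz v w = 1 / 2"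
    and cross_v: "lcross q v = \<epsilon> *\<^sub>R v" and cross_w: "lcross q w = - (\<epsilon> *\<^sub>R w)"

lemma null_frame_swap: "null_frame \<epsilon> q v w \<Longrightarrow> null_frame (- \<epsilon>) q w v"
  by (auto simp: null_frame_def lorentz_commute)

lemma null_frame_exists:
  assumes "lorentz q q = 1" "\<epsilon> * \<epsilon> = 1"
  obtains v w where "null_frame \<epsilon> q v w"
proof -
  define k where "k = 1 + (q $ 0)\<^sup>2"
  have k: "k \<noteq> 0" unfolding k_def by (metis power_one sum_power2_eq_zero_iff zero_neq_one)
  have kq: "q $ 1 * q $ 1 + q $ 2 * q $ 2 = k"
    using assms(1) by (simp add: lorentz_def k_def power2_eq_square)
  have kq0: "k = 1 + q $ 0 * q $ 0" by (simp add: k_def power2_eq_square)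
  \<comment> \<open>The light-like tangent vectors at \<open>q\<close> whose time coordinate is \<open>1 + q\<^sub>0\<^sup>2 = q\<^sub>1\<^sup>2 + q\<^sub>2\<^sup>2\<close>.\<close>
  define v w :: "real^3"
    where "v = (\<chi> i. if i = 0 then k else if i = 1 then q $ 0 * q $ 1 - q $ 2 else q $ 0 * q $ 2 + q $ 1)"
      and "w = (\<chi> i. if i = 0 then k else if i = 1 then q $ 0 * q $ 1 + q $ 2 else q $ 0 * q $ 2 - q $ 1)"
  define w' where "w' = (- 1 / (4 * k)) *\<^sub>R w"
  have v: "v $ 0 = k" "v $ 1 = q $ 0 * q $ 1 - q $ 2" "v $ 2 = q $ 0 * q $ 2 + q $ 1"
    and w: "w $ 0 = k" "w $ 1 = q $ 0 * q $ 1 + q $ 2" "w $ 2 = q $ 0 * q $ 2 - q $ 1"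
    by (simp_all add: v_def w_def)
  have a: "lorentz q v = 0" "lorentz v v = 0"
    unfolding lorentz_def v using kq kq0 by Groebner_Basis.algebra+
  have "lcross q v = - v"
    unfolding vec3_eq_iff lcross_nth vector_uminus_component v
    using kq by (simp add: kq0 algebra_simps)
  note a = a this
  have b: "lorentz q w = 0" "lorentz w w = 0"
    unfolding lorentz_def w using kq kq0 by Groebner_Basis.algebra+
  have "lcross q w = w"
    unfolding vec3_eq_iff lcross_nth w
    using kq by (simp add: kq0 algebra_simps)
  note b = b this
  have c: "lorentz v w = - 2 * k"
    unfolding lorentz_def v w using kq kq0 by Groebner_Basis.algebra
  have f: "null_frame (-1) q v w'"
    unfolding null_frame_def using a b c k assms(1)
    by (simp add: w'_def)
  from assms(2) have "\<epsilon> = 1 \<or> \<epsilon> = -1" by (metis mult_1_left square_eq_iff mult.right_neutral power2_eq_1_iff power2_eq_square)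
  with f null_frame_swap[OF f] that show thesis by auto
qed

context null_frame
begin

lemma abs_eps: "\<bar>\<epsilon>\<bar> = 1" "\<bar>- \<epsilon>\<bar> = 1"
  using eps by (metis abs_minus_cancel abs_mult_self_eq abs_1 abs_mult real_sqrt_abs2 real_sqrt_one)+

lemma cross_vw: "lcross v w = (\<epsilon> / 2) *\<^sub>R q"
proof -
  have "lcross v (lcross q w) = - (1 / 2) *\<^sub>R q"
    using qv vw by (simp add: lcross_lcross lorentz_commute[of v q])
  then have "\<epsilon> *\<^sub>R (\<epsilon> *\<^sub>R lcross v w) = \<epsilon> *\<^sub>R ((1 / 2) *\<^sub>R q)"
    by (simp add: cross_w)
  then show ?thesis using eps by (simp add: scaleR_scaleR)
qed

lemma frame_det: "lorentz (lcross q v) w = \<epsilon> / 2"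
  by (simp add: cross_v vw)

lemma expansion: "x = lorentz q x *\<^sub>R q + (2 * lorentz w x) *\<^sub>R v + (2 * lorentz v x) *\<^sub>R w"
proof -
  have "(\<epsilon> / 2) *\<^sub>R x = lorentz x q *\<^sub>R ((\<epsilon> / 2) *\<^sub>R q) + lorentz x v *\<^sub>R (\<epsilon> *\<^sub>R w) + lorentz x w *\<^sub>R (\<epsilon> *\<^sub>R v)"
    using lcross_expansion[of q v w x, unfolded frame_det] lcross_anticommute[of w q]
    by (simp add: cross_v cross_w cross_vw)
  then have "(2 * \<epsilon>) *\<^sub>R ((\<epsilon> / 2) *\<^sub>R x) = (2 * \<epsilon>) *\<^sub>R (lorentz x q *\<^sub>R ((\<epsilon> / 2) *\<^sub>R q) + lorentz x v *\<^sub>R (\<epsilon> *\<^sub>R w) + lorentz x w *\<^sub>R (\<epsilon> *\<^sub>R v))"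
    by simp
  moreover have "\<epsilon> * (r * \<epsilon>) = r" for r using eps by Groebner_Basis.algebra
  ultimately show ?thesis
    using eps by (simp add: scaleR_right_distrib lorentz_commute mult.assoc mult.left_commute[of 2] add_ac)
qed

text \<open>
  For \<open>p = \<alpha> q + \<beta> v + \<gamma> w\<close> these are \<open>\<beta> / (1 -
  \<alpha>)\<close> and \<open>\<gamma> / (1 - \<alpha>)\<close>. By \<open>\<beta> \<gamma> = (1 -
  \<alpha>) (1 + \<alpha>)\<close> they parametrize the two rulings; the two lines through
  \<open>q\<close> have the parameter \<open>\<infinity>\<close>.
\<close>

definition s :: "real^3 \<Rightarrow> real" where "s p = 2 * lorentz w p / (1 - lorentz q p)"
definition t :: "real^3 \<Rightarrow> real" where "t p = 2 * lorentz v p / (1 - lorentz q p)"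

text \<open>
  This expresses that \<open>s\<close> has derivative zero along the line through \<open>p\<close> in
  direction \<open>u\<close>: rewriting the double cross product \<open>lcross q (lcross p u)\<close>
  uses the eigenvalue \<open>\<epsilon>\<close> of \<open>u\<close> once and the eigenvalue
  \<open>-\<epsilon>\<close> of \<open>w\<close> once.
\<close>

lemma null_direction_coord:
  assumes "null_direction \<epsilon> p u"
  shows "lorentz w u * (1 - lorentz q p) + lorentz w p * lorentz q u = 0"
proof -
  note u = null_direction_imp[OF assms abs_eps(1)]
  have "lorentz q p * lorentz w u - lorentz q u * lorentz w p = lorentz w (lcross q (lcross p u))"
    by (simp add: lcross_lcross)
  also have "\<dots> = \<epsilon> * lorentz (lcross q u) w"
    by (simp add: u lorentz_commute)
  also have "lorentz (lcross q u) w = lorentz (lcross w q) u"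
    by (simp only: lorentz_lcross_cyclic)
  also have "lcross w q = \<epsilon> *\<^sub>R w"
    using lcross_anticommute[of w q] cross_w by simp
  finally have "lorentz q p * lorentz w u - lorentz q u * lorentz w p = (\<epsilon> * \<epsilon>) * lorentz w u"
    by simp
  then show ?thesis using eps by (simp add: algebra_simps)
qed

lemma lorentz_expansion:
  "lorentz x y = lorentz q x * lorentz q y + 2 * lorentz w x * lorentz v y + 2 * lorentz v x * lorentz w y"
proof -
  have "lorentz x y = lorentz (lorentz q x *\<^sub>R q + (2 * lorentz w x) *\<^sub>R v + (2 * lorentz v x) *\<^sub>R w) y"
    by (simp only: expansion[of x, symmetric])
  then show ?thesis by simp
qed

end

section \<open>The curve in the coordinates of a null frame\<close>

text \<open>
  The chord through the point with coordinates \<open>(S, T)\<close>, in the direction \<open>S q -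
  S\<^sup>2 v + w\<close> and with parameter \<open>\<sigma>\<close>, ends at the point with coordinates
  \<open>(S, T')\<close>, where \<open>\<delta> = 1 - \<langle>q, p\<rangle>\<close>. The assumption
  \<open>G\<close> is the condition on chords, in which a factor \<open>\<sigma>\<close> has been
  cancelled; so the conclusion also holds at double roots, where a computation with the difference
  \<open>T' - T\<close> would lose it.
\<close>

lemma vieta_from_chord_condition:
  fixes b c k1 k2 k3 S T T' \<delta> \<sigma> :: real
  assumes F: "(S * T - 1) * (b * S + c * T) + k1 * S\<^sup>2 + k2 * T\<^sup>2 + 2 * k3 * S * T = 0"
    and \<delta>: "\<delta> * (S * T + 1) = 2"
    and \<sigma>: "\<sigma> * (1 + S * T') = \<delta> * (T' - T)"
    and G: "2 * ((1 - \<delta>) * (c - S\<^sup>2 * b) + S * \<delta> * (S * b - S\<^sup>2 * k1 + k3) + T * \<delta> * (S * c - S\<^sup>2 * k3 + k2))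
      + \<sigma> * (2 * S * c - 2 * S ^ 3 * b + S ^ 4 * k1 + k2 - 2 * S\<^sup>2 * k3) = 0"
  shows "\<delta> * ((c * S + k2) * (T + T') + (b * S\<^sup>2 + 2 * k3 * S - c)) = 0"
proof -
  have "(S * T' + 1) * (2 * ((1 - \<delta>) * (c - S\<^sup>2 * b) + S * \<delta> * (S * b - S\<^sup>2 * k1 + k3) + T * \<delta> * (S * c - S\<^sup>2 * k3 + k2)))
      + \<delta> * (T' - T) * (2 * S * c - 2 * S ^ 3 * b + S ^ 4 * k1 + k2 - 2 * S\<^sup>2 * k3) = 0"
    using \<sigma> G by Groebner_Basis.algebra
  then show ?thesis using F \<delta> by Groebner_Basis.algebra
qed

text \<open>
  Both sides are cubic polynomials in \<open>x\<close> with the same leading coefficient; the values at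
  \<open>0\<close>, \<open>1\<close> and \<open>-1\<close> determine the other coefficients.
\<close>

lemma discriminant_coefficients:
  fixes d0 d1 d2 b c k1 k2 k3 :: real assumes p: "\<And>x::real. - x * (k1 * k2 - (k3 - x / 2)\<^sup>2) - (b\<^sup>2 * k2 + c\<^sup>2 * k1 - 2 * b * c * (k3 - x / 2)) =
    - ((d0 - x) * (d1 - x) * (d2 - x)) / 4"
 shows "d0 + d1 + d2 = 4 * k3"
  "d0 * d1 + d0 * d2 + d1 * d2 = 4 * k3\<^sup>2 - 4 * k1 * k2 - 4 * b * c"
  "d0 * d1 * d2 = 4 * (b\<^sup>2 * k2 + c\<^sup>2 * k1 - 2 * b * c * k3)"
proof -
  have P: "d0 * d1 * d2 - (d0 * d1 + d0 * d2 + d1 * d2) * x + (d0 + d1 + d2) * x\<^sup>2 =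
    4 * (b\<^sup>2 * k2 + c\<^sup>2 * k1 - 2 * b * c * k3) - (4 * k3\<^sup>2 - 4 * k1 * k2 - 4 * b * c) * x + 4 * k3 * x\<^sup>2"
    for x :: real
  proof -
    have "4 * (b\<^sup>2 * k2 + c\<^sup>2 * k1 - 2 * b * c * k3) - (4 * k3\<^sup>2 - 4 * k1 * k2 - 4 * b * c) * x + 4 * k3 * x\<^sup>2 - x ^ 3 =
      - 4 * (- x * (k1 * k2 - (k3 - x / 2)\<^sup>2) - (b\<^sup>2 * k2 + c\<^sup>2 * k1 - 2 * b * c * (k3 - x / 2)))"
      by (simp add: algebra_simps power2_eq_square power3_eq_cube)
    also have "\<dots> = (d0 - x) * (d1 - x) * (d2 - x)"
      unfolding p by simp
    also have "\<dots> = d0 * d1 * d2 - (d0 * d1 + d0 * d2 + d1 * d2) * x + (d0 + d1 + d2) * x\<^sup>2 - x ^ 3"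
      by (simp add: algebra_simps power2_eq_square power3_eq_cube)
    finally show ?thesis by simp
  qed
  show "d0 + d1 + d2 = 4 * k3"
  "d0 * d1 + d0 * d2 + d1 * d2 = 4 * k3\<^sup>2 - 4 * k1 * k2 - 4 * b * c"
  "d0 * d1 * d2 = 4 * (b\<^sup>2 * k2 + c\<^sup>2 * k1 - 2 * b * c * k3)"
    using P[of 0] P[of 1] P[of "-1"] by simp_all
qed

text \<open>
  The point \<open>q\<close> lies on the curve, which lowers the degree of the equation in \<open>(s,
  t)\<close>: it has no term \<open>s\<^sup>2 t\<^sup>2\<close>.
\<close>

locale chord_frame = null_frame +
  fixes d0 d1 d2 :: real
  assumes Kqq: "diag_form d0 d1 d2 q q = 0"
begin

abbreviation K where "K \<equiv> diag_form d0 d1 d2"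
abbreviation b where "b \<equiv> K q v"
abbreviation c where "c \<equiv> K q w"
abbreviation k1 where "k1 \<equiv> K v v"
abbreviation k2 where "k2 \<equiv> K w w"
abbreviation k3 where "k3 \<equiv> K v w"

lemma K_q [simp]: "K q q = 0" "K v q = b" "K w q = c" "K w v = k3"
  using Kqq by (simp_all add: diag_form_commute)

lemma coordinates:
  assumes "lorentz p p = 1" "lorentz q p \<noteq> 1"
  defines "\<delta> \<equiv> 1 - lorentz q p"
  shows "p = (1 - \<delta>) *\<^sub>R q + (s p * \<delta>) *\<^sub>R v + (t p * \<delta>) *\<^sub>R w"
    and "\<delta> * (s p * t p + 1) = 2" and "\<delta> \<noteq> 0"
proof -
  show \<delta>: "\<delta> \<noteq> 0" using assms(2) by (simp add: \<delta>_def)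
  then have c: "lorentz q p = 1 - \<delta>" "2 * lorentz w p = s p * \<delta>" "2 * lorentz v p = t p * \<delta>"
    by (simp_all add: s_def t_def \<delta>_def)
  then show "p = (1 - \<delta>) *\<^sub>R q + (s p * \<delta>) *\<^sub>R v + (t p * \<delta>) *\<^sub>R w"
    using expansion[of p] by simp
  have "1 = (lorentz q p)\<^sup>2 + (2 * lorentz w p) * (2 * lorentz v p)"
    using lorentz_expansion[of p p] assms(1) by (simp add: power2_eq_square mult.commute[of "lorentz w p"])
  then have "\<delta> * (\<delta> * (s p * t p + 1) - 2) = 0"
    unfolding c by (simp add: power2_eq_square algebra_simps)
  then show "\<delta> * (s p * t p + 1) = 2" using \<delta> by simp
qed

lemma curve_equation:
  assumes "p \<in> boundary K" "lorentz q p \<noteq> 1"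
  shows "(s p * t p - 1) * (b * s p + c * t p) + k1 * (s p)\<^sup>2 + k2 * (t p)\<^sup>2 + 2 * k3 * s p * t p = 0"
proof -
  define S T \<delta> where "S = s p" and "T = t p" and "\<delta> = 1 - lorentz q p"
  have p: "lorentz p p = 1" "K p p = 0" using assms(1) by (auto simp: boundary_def)
  note co = coordinates[OF p(1) assms(2), folded S_def T_def \<delta>_def]
  have "K p p = K ((1 - \<delta>) *\<^sub>R q + (S * \<delta>) *\<^sub>R v + (T * \<delta>) *\<^sub>R w) ((1 - \<delta>) *\<^sub>R q + (S * \<delta>) *\<^sub>R v + (T * \<delta>) *\<^sub>R w)"
    by (simp only: co(1)[symmetric])
  then have "\<delta> * (2 * (1 - \<delta>) * (S * b + T * c) + \<delta> * (S\<^sup>2 * k1 + T\<^sup>2 * k2 + 2 * S * T * k3)) = 0"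
    using p(2) by (simp add: algebra_simps power2_eq_square)
  then have "2 * (1 - \<delta>) * (S * b + T * c) + \<delta> * (S\<^sup>2 * k1 + T\<^sup>2 * k2 + 2 * S * T * k3) = 0"
    using co(3) by simp
  then have "\<delta> * ((S * T - 1) * (b * S + c * T) + k1 * S\<^sup>2 + k2 * T\<^sup>2 + 2 * k3 * S * T) = 0"
    using co(2) by Groebner_Basis.algebra
  then show ?thesis using co(3) by (simp add: S_def T_def)
qed

text \<open>
  A light-like line of the ruling \<open>\<epsilon>\<close> is a line \<open>s = const\<close>. The
  equation of the curve is quadratic in \<open>t\<close>, and a chord joins its two roots; their sum is
  given by the coefficients.
\<close>

lemma chord_vieta:
  assumes "p \<in> boundary K" "chord K \<epsilon> p p'" "lorentz q p \<noteq> 1" "lorentz q p' \<noteq> 1"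
  shows "s p' = s p"
    and "(c * s p + k2) * (t p + t p') = - (b * (s p)\<^sup>2 + 2 * k3 * s p - c)"
proof -
  obtain u0 \<tau> where u0: "null_direction \<epsilon> p u0" "p' = p + \<tau> *\<^sub>R u0" "2 * K p u0 + \<tau> * K u0 u0 = 0"
    using assms(2) by (auto simp: chord_def)
  note n = null_direction_imp[OF u0(1) abs_eps(1)]
  define S T T' \<delta> where "S = s p" and "T = t p" and "T' = t p'" and "\<delta> = 1 - lorentz q p"
  have p: "lorentz p p = 1" using assms(1) by (auto simp: boundary_def)
  note co = coordinates[OF p assms(3), folded S_def T_def \<delta>_def]
  have c: "lorentz q p = 1 - \<delta>" "lorentz w p = S * \<delta> / 2" "lorentz v p = T * \<delta> / 2"
    using co(3) by (simp_all add: S_def T_def s_def t_def \<delta>_def)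
  define l where "l = lorentz q u0"
  define e where "e = 2 * lorentz v u0"
  have "\<delta> * (lorentz w u0 + S * l / 2) = 0"
    using null_direction_coord[OF u0(1)] c by (simp add: l_def \<delta>_def[symmetric] algebra_simps)
  then have wu: "2 * lorentz w u0 = - S * l" using co(3) by simp
  have "(1 - \<delta>) * (2 * l) + S * \<delta> * e - T * \<delta> * S * l = 0"
  proof -
    have "0 = 2 * (lorentz q p * lorentz q u0 + (2 * lorentz w p) * lorentz v u0 + lorentz v p * (2 * lorentz w u0))"
      using lorentz_expansion[of p u0] n(3) by simp
    also have "\<dots> = (1 - \<delta>) * (2 * l) + S * \<delta> * e - T * \<delta> * S * l"
      unfolding wu unfolding c by (simp add: l_def e_def algebra_simps)
    finally show ?thesis by simp
  qed
  then have "\<delta> * (l - S * e) = 0" using co(2) by Groebner_Basis.algebra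
  then have l: "l = S * e" using co(3) by simp
  define g where "g = S *\<^sub>R q - (S\<^sup>2) *\<^sub>R v + w"
  have u: "u0 = e *\<^sub>R g"
  proof -
    have "u0 = l *\<^sub>R q + (2 * lorentz w u0) *\<^sub>R v + e *\<^sub>R w"
      using expansion[of u0] by (simp only: l_def e_def)
    then show ?thesis
      unfolding wu l g_def by (simp add: algebra_simps power2_eq_square)
  qed
  then have e: "e \<noteq> 0" using n(1) by auto
  define \<sigma> where "\<sigma> = \<tau> * e"
  have p': "p' = p + \<sigma> *\<^sub>R g" by (simp add: u0(2) u \<sigma>_def)
  have "e * (2 * K p g + \<sigma> * K g g) = 0"
    using u0(3) by (simp add: u \<sigma>_def algebra_simps)
  then have Kg: "2 * K p g + \<sigma> * K g g = 0" using e by simp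
  have qp': "1 - lorentz q p' = \<delta> - \<sigma> * S"
    by (simp add: p' g_def qq qv qw c)
  then have \<delta>': "\<delta> - \<sigma> * S \<noteq> 0" using assms(4) by simp
  have "s p' = S * (\<delta> - \<sigma> * S) / (\<delta> - \<sigma> * S)"
    unfolding s_def qp'
    by (simp add: p' g_def lorentz_commute[of w q] lorentz_commute[of w v] qw vw ww c power2_eq_square algebra_simps)
  then show "s p' = s p" using \<delta>' by (simp add: S_def)
  have "T' * (\<delta> - \<sigma> * S) = T * \<delta> + \<sigma>"
    unfolding T'_def t_def qp' using \<delta>'
    by (simp add: p' g_def lorentz_commute[of v q] qv vw vv c)
  then have \<sigma>: "\<sigma> * (1 + S * T') = \<delta> * (T' - T)" by (simp add: algebra_simps)
  have Kpg: "K p g = (1 - \<delta>) * (c - S\<^sup>2 * b) + S * \<delta> * (S * b - S\<^sup>2 * k1 + k3) + T * \<delta> * (S * c - S\<^sup>2 * k3 + k2)"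
    by (subst co(1)) (simp add: g_def algebra_simps)
  have Kgg: "K g g = 2 * S * c - 2 * S ^ 3 * b + S ^ 4 * k1 + k2 - 2 * S\<^sup>2 * k3"
    by (simp add: g_def algebra_simps power2_eq_square power3_eq_cube power4_eq_xxxx)
  have F: "(S * T - 1) * (b * S + c * T) + k1 * S\<^sup>2 + k2 * T\<^sup>2 + 2 * k3 * S * T = 0"
    using curve_equation[OF assms(1,3)] by (simp add: S_def T_def)
  have "\<delta> * ((c * S + k2) * (T + T') + (b * S\<^sup>2 + 2 * k3 * S - c)) = 0"
    by (rule vieta_from_chord_condition[OF F co(2) \<sigma> Kg[unfolded Kpg Kgg]])
  then show "(c * s p + k2) * (t p + t p') = - (b * (s p)\<^sup>2 + 2 * k3 * s p - c)"
    using co(3) by (simp add: S_def T_def T'_def)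
qed

lemma swapped_chord_frame: "chord_frame (- \<epsilon>) q w v d0 d1 d2"
  using null_frame_swap[OF null_frame_axioms] Kqq by (simp add: chord_frame_def chord_frame_axioms_def)

text \<open>
  Exchanging \<open>v\<close> and \<open>w\<close> exchanges the rulings and the coordinates
  \<open>s\<close> and \<open>t\<close>.
\<close>

lemma chord_vieta':
  assumes "p \<in> boundary K" "chord K (- \<epsilon>) p p'" "lorentz q p \<noteq> 1" "lorentz q p' \<noteq> 1"
  shows "t p' = t p"
    and "(b * t p + k1) * (s p + s p') = - (c * (t p)\<^sup>2 + 2 * k3 * t p - b)"
proof -
  interpret sw: chord_frame "- \<epsilon>" q w v d0 d1 d2 by (rule swapped_chord_frame)
  have "sw.s = t" "sw.t = s" by (simp_all add: fun_eq_iff sw.s_def sw.t_def s_def t_def del: sw.K_q)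
  then show "t p' = t p" "(b * t p + k1) * (s p + s p') = - (c * (t p)\<^sup>2 + 2 * k3 * t p - b)"
    \<comment> \<open>The commutation rules for \<open>K\<close> from both frames together would rewrite back and forth.\<close>
    using sw.chord_vieta[OF assms] by (simp_all del: sw.K_q)
qed

text \<open>
  This is \<open>-1/X\<close> for the parameter \<open>X\<close> of the quadric in the pencil \<open>X
  \<langle>A\<inverse>x, x\<rangle> = \<langle>x, x\<rangle> - 1\<close> whose tangent plane at
  \<open>q\<close> contains \<open>p\<close>.
\<close>

lemma pencil_coordinate:
  assumes "lorentz p p = 1" "lorentz q p \<noteq> 1"
  shows "b * s p + c * t p = K q p / (1 - lorentz q p)"
proof -
  define S T \<delta> where "S = s p" and "T = t p" and "\<delta> = 1 - lorentz q p"
  note co = coordinates[OF assms, folded S_def T_def \<delta>_def]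
  have "K q p = K q ((1 - \<delta>) *\<^sub>R q + (S * \<delta>) *\<^sub>R v + (T * \<delta>) *\<^sub>R w)"
    by (simp only: co(1)[symmetric])
  also have "\<dots> = \<delta> * (b * S + c * T)" by (simp add: algebra_simps)
  finally show ?thesis using co(3) by (simp add: S_def T_def \<delta>_def field_simps)
qed

lemma pencil_discriminant:
  "- x * (k1 * k2 - (k3 - x / 2)\<^sup>2) - (b\<^sup>2 * k2 + c\<^sup>2 * k1 - 2 * b * c * (k3 - x / 2)) =
    - ((d0 - x) * (d1 - x) * (d2 - x)) / 4"
proof -
  have expand: "- x * (k1 * k2 - (k3 - x / 2)\<^sup>2) - (b\<^sup>2 * k2 + c\<^sup>2 * k1 - 2 * b * c * (k3 - x / 2)) =
    (0 - x * 1) * ((k1 - x * 0) * (k2 - x * 0) - (k3 - x * (1 / 2))\<^sup>2) -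
    (b - x * 0) * ((b - x * 0) * (k2 - x * 0) - (k3 - x * (1 / 2)) * (c - x * 0)) +
    (c - x * 0) * ((b - x * 0) * (k3 - x * (1 / 2)) - (k1 - x * 0) * (c - x * 0))"
    for b c k1 k2 k3 :: real
    by (simp add: algebra_simps power2_eq_square)
  have K: "diag_form (d0 - x) (d1 - x) (d2 - x) a a' = K a a' - x * lorentz a a'" for a a'
    by (simp add: diag_form_def lorentz_def algebra_simps)
  have "(lorentz (lcross q v) w)\<^sup>2 = 1 / 4"
    using eps by (simp add: frame_det power2_eq_square)
  moreover have "- x * (k1 * k2 - (k3 - x / 2)\<^sup>2) - (b\<^sup>2 * k2 + c\<^sup>2 * k1 - 2 * b * c * (k3 - x / 2)) =
    - ((d0 - x) * (d1 - x) * (d2 - x)) * (lorentz (lcross q v) w)\<^sup>2"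
    unfolding gram_det_diag_form[of "d0 - x" "d1 - x" "d2 - x" q v w, symmetric] K qq qv qw vv ww vw K_q
    by (rule expand)
  ultimately show ?thesis by simp
qed

text \<open>
  The coefficients of the cubic under the root in terms of the equation of the curve. The left sides do
  not depend on the point \<open>q\<close>, and this is what makes the final condition independent of
  the trajectory.
\<close>

lemma symmetric_functions:
  "d0 + d1 + d2 = 4 * k3"
  "d0 * d1 + d0 * d2 + d1 * d2 = 4 * k3\<^sup>2 - 4 * k1 * k2 - 4 * b * c"
  "d0 * d1 * d2 = 4 * (b\<^sup>2 * k2 + c\<^sup>2 * k1 - 2 * b * c * k3)"
  using discriminant_coefficients[OF pencil_discriminant] by blast+

end

text \<open>
  Two flights lead from \<open>(s, t)\<close> through \<open>(s, t')\<close> to \<open>(s', t')\<close>.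
  The first three identities are the coefficients of \<open>X\<^sup>2\<close>, \<open>X\<^sup>3\<close>,
  \<open>X\<^sup>4\<close> in \<open>(1 - 2 k\<^sub>3 X + \<beta> X\<^sup>2)\<^sup>2 - y\<^sup>2 = \<mu>
  X\<^sup>2 (1 + z X) (1 + z' X)\<close>. The last two express \<open>\<beta>\<close>, which is defined
  at the middle point, by the coordinates of either end; they allow to compare consecutive steps.
\<close>

lemma step_identities:
  fixes b c k1 k2 k3 s t s' t' :: "'a::idom"
  assumes S: "(s * t' - 1) * (b * s + c * t') + k1 * s\<^sup>2 + k2 * t'\<^sup>2 + 2 * k3 * s * t' = 0"
    and 1: "(c * s + k2) * (t + t') = - (b * s\<^sup>2 + 2 * k3 * s - c)"
    and 2: "(b * t' + k1) * (s + s') = - (c * t'\<^sup>2 + 2 * k3 * t' - b)"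
  defines "\<beta> \<equiv> 2 * (b * c * (s * t' - 1) + k1 * c * s + k2 * b * t')"
    and "\<mu> \<equiv> 4 * (b * t' + k1) * (c * s + k2)"
    and "z \<equiv> b * s + c * t" and "z' \<equiv> b * s' + c * t'"
  shows "2 * \<beta> + 4 * k1 * k2 + 4 * b * c = \<mu>"
    and "4 * (b\<^sup>2 * k2 + c\<^sup>2 * k1 - 2 * b * c * k3) - 4 * k3 * \<beta> = \<mu> * (z + z')"
    and "\<beta>\<^sup>2 = \<mu> * z * z'"
    and "\<beta> = - 2 * b * s * z - 4 * k3 * b * s + 2 * k1 * c * s - 2 * k2 * b * t"
    and "\<beta> = - 2 * c * t' * z' - 4 * k3 * c * t' - 2 * k1 * c * s' + 2 * k2 * b * t'"
proof -
  show "2 * \<beta> + 4 * k1 * k2 + 4 * b * c = \<mu>"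
    unfolding \<beta>_def \<mu>_def by Groebner_Basis.algebra
  show "\<beta> = - 2 * b * s * z - 4 * k3 * b * s + 2 * k1 * c * s - 2 * k2 * b * t"
    unfolding \<beta>_def z_def using 1 by Groebner_Basis.algebra
  show "\<beta> = - 2 * c * t' * z' - 4 * k3 * c * t' - 2 * k1 * c * s' + 2 * k2 * b * t'"
    unfolding \<beta>_def z'_def using 2 by Groebner_Basis.algebra
  have z: "(c * s + k2) * z = b * k2 * s - c\<^sup>2 * s * t' - c * k2 * t' - 2 * k3 * c * s + c\<^sup>2"
    unfolding z_def using 1 by Groebner_Basis.algebra
  have z': "(b * t' + k1) * z' = c * k1 * t' - b\<^sup>2 * s * t' - b * k1 * s - 2 * k3 * b * t' + b\<^sup>2"
    unfolding z'_def using 2 by Groebner_Basis.algebra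
  \<comment> \<open>Multiplied by the respective factor of \<open>\<mu>\<close>, the Vieta relations turn \<open>z\<close> and \<open>z'\<close> into polynomials in
    the coordinates \<open>s\<close>, \<open>t'\<close> of the middle point. Comparing coefficients then yields the multiples of the
    equation \<open>?F\<close> of the curve that have to be subtracted.\<close>
  let ?Z = "b * k2 * s - c\<^sup>2 * s * t' - c * k2 * t' - 2 * k3 * c * s + c\<^sup>2"
  let ?Z' = "c * k1 * t' - b\<^sup>2 * s * t' - b * k1 * s - 2 * k3 * b * t' + b\<^sup>2"
  let ?F = "(s * t' - 1) * (b * s + c * t') + k1 * s\<^sup>2 + k2 * t'\<^sup>2 + 2 * k3 * s * t'"
  have "\<mu> * (z + z') = 4 * (b * t' + k1) * ((c * s + k2) * z) + 4 * (c * s + k2) * ((b * t' + k1) * z')"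
    unfolding \<mu>_def by (simp add: algebra_simps)
  also have "\<dots> = 4 * (b * t' + k1) * ?Z + 4 * (c * s + k2) * ?Z'"
    by (simp only: z z')
  also have "\<dots> = 4 * (b\<^sup>2 * k2 + c\<^sup>2 * k1 - 2 * b * c * k3) - 4 * k3 * \<beta> - 4 * b * c * ?F"
    unfolding \<beta>_def by Groebner_Basis.algebra
  finally show "4 * (b\<^sup>2 * k2 + c\<^sup>2 * k1 - 2 * b * c * k3) - 4 * k3 * \<beta> = \<mu> * (z + z')"
    by (simp add: S)
  have "\<mu> * z * z' = 4 * ((c * s + k2) * z) * ((b * t' + k1) * z')"
    unfolding \<mu>_def by (simp add: algebra_simps)
  also have "\<dots> = 4 * ?Z * ?Z'"
    by (simp only: z z')
  also have "\<dots> = \<beta>\<^sup>2 - 4 * (c\<^sup>2 * k1 + b\<^sup>2 * k2 - 2 * b * c * k3) * ?F"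
    unfolding \<beta>_def by Groebner_Basis.algebra
  finally show "\<beta>\<^sup>2 = \<mu> * z * z'"
    by (simp add: S)
qed



lemma norm_identity:
  fixes d0 d1 d2 k3 \<beta> \<mu> z z' :: "'a::comm_ring_1"
  assumes "d0 + d1 + d2 = 4 * k3"
    and "4 * k3\<^sup>2 + 2 * \<beta> - (d0 * d1 + d0 * d2 + d1 * d2) = \<mu>"
    and "d0 * d1 * d2 - 4 * k3 * \<beta> = \<mu> * (z + z')"
    and "\<beta>\<^sup>2 = \<mu> * z * z'"
  shows "[:1, - 2 * k3, \<beta>:]\<^sup>2 - [:1, - d0:] * [:1, - d1:] * [:1, - d2:] =
    Polynomial.smult \<mu> ([:0, 1:]\<^sup>2 * [:1, z:] * [:1, z':])"
proof -
  have "[:1, - 2 * k3, \<beta>:]\<^sup>2 - [:1, - d0:] * [:1, - d1:] * [:1, - d2:] =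
    [:0, d0 + d1 + d2 - 4 * k3, 4 * k3\<^sup>2 + 2 * \<beta> - (d0 * d1 + d0 * d2 + d1 * d2),
      d0 * d1 * d2 - 4 * k3 * \<beta>, \<beta>\<^sup>2:]"
    by (simp add: power2_eq_square algebra_simps)
  also have "\<dots> = [:0, 0, \<mu>, \<mu> * (z + z'), \<mu> * z * z':]"
    unfolding assms by simp
  also have "\<dots> = Polynomial.smult \<mu> ([:0, 1:]\<^sup>2 * [:1, z:] * [:1, z':])"
    by (simp add: power2_eq_square algebra_simps)
  finally show ?thesis .
qed

section \<open>Generic points of the boundary\<close>

text \<open>
  The polynomial is not a square in the field of rational functions, with the denominator cleared.
\<close>

definition non_square :: "complex poly \<Rightarrow> bool" where
  "non_square A \<longleftrightarrow> (\<forall>M N. M\<^sup>2 = A * N\<^sup>2 \<longrightarrow> N = 0)"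

lemma non_square_nonzero:
  assumes "non_square A" shows "A \<noteq> 0"
proof
  assume "A = 0"
  then have "0\<^sup>2 = A * 1\<^sup>2" by simp
  with assms have "(1 :: complex poly) = 0" unfolding non_square_def by blast
  then show False by simp
qed

text \<open>
  A simple root has odd order in the product with any square.
\<close>

lemma non_square_simple_root:
  assumes "poly G r \<noteq> 0"
  shows "non_square ([:- r, 1:] * G)"
  unfolding non_square_def
proof (intro allI impI)
  fix M N assume eq: "M\<^sup>2 = [:- r, 1:] * G * N\<^sup>2"
  show "N = 0"
  proof (rule ccontr)
    assume N: "N \<noteq> 0"
    have G: "G \<noteq> 0" using assms by auto
    have R: "[:- r, 1:] * G * N\<^sup>2 \<noteq> 0" using N G by (simp del: mult_pCons_left)
    have "order r ([:- r, 1:] * G * N\<^sup>2) = order r [:- r, 1:] + order r G + order r (N\<^sup>2)"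
    proof -
      have "[:- r, 1:] * G \<noteq> 0" using G by (simp del: mult_pCons_left)
      then show ?thesis
        using order_mult[OF R, of r] order_mult[of "[:- r, 1:]" G r]
        by (simp del: mult_pCons_left)
    qed
    also have "order r [:- r, 1:] = 1"
      using order_power_n_n[of r 1] by simp
    also have "order r G = 0" using assms by (simp add: order_root)
    also have "order r (N\<^sup>2) = 2 * order r N"
      using N by (simp add: power2_eq_square order_mult)
    finally have "odd (order r (M\<^sup>2))" unfolding eq by simp
    moreover have "M \<noteq> 0" using R eq by auto
    then have "order r (M\<^sup>2) = 2 * order r M"
      by (simp add: power2_eq_square order_mult)
    ultimately show False by simp
  qed
qed

lemma poly_eq_0_of_infinite_zeros:
  fixes P :: "complex poly"
  assumes "infinite Z" "\<And>u. u \<in> Z \<Longrightarrow> poly P u = 0"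
  shows "P = 0"
  using assms poly_roots_finite[of P] by (metis (mono_tags, lifting) finite_subset mem_Collect_eq subsetI)

text \<open>
  The functions \<open>1\<close>, \<open>\<surd>A\<close>, \<open>\<surd>B\<close>, \<open>\<surd>(A
  B)\<close> are linearly independent over the rational functions if none of \<open>A\<close>,
  \<open>B\<close>, \<open>A B\<close> is a square. Taking norms removes first \<open>\<eta>\<close> and
  then \<open>\<xi>\<close>, and leaves an identity of polynomials.
\<close>

lemma independent_square_roots:
  fixes A B P0 P1 P2 P3 :: "complex poly"
  assumes ns: "non_square A" "non_square B" "non_square (A * B)"
    and Z: "infinite Z"
    and roots: "\<And>u. u \<in> Z \<Longrightarrow> (\<xi> u)\<^sup>2 = poly A u" "\<And>u. u \<in> Z \<Longrightarrow> (\<eta> u)\<^sup>2 = poly B u"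
    and zero: "\<And>u. u \<in> Z \<Longrightarrow> poly P0 u + poly P1 u * \<xi> u + poly P2 u * \<eta> u + poly P3 u * \<xi> u * \<eta> u = 0"
  shows "P0 = 0" "P1 = 0" "P2 = 0" "P3 = 0"
proof -
  define M where "M = P0\<^sup>2 + A * P1\<^sup>2 - B * (P2\<^sup>2 + A * P3\<^sup>2)"
  define N where "N = 2 * (P0 * P1 - B * P2 * P3)"
  have "M\<^sup>2 - A * N\<^sup>2 = 0"
  proof (rule poly_eq_0_of_infinite_zeros[OF Z])
    fix u assume u: "u \<in> Z"
    define p0 p1 p2 p3 a b where "p0 = poly P0 u" and "p1 = poly P1 u" and "p2 = poly P2 u"
      and "p3 = poly P3 u" and "a = poly A u" and "b = poly B u"
    have r: "(\<xi> u)\<^sup>2 = a" "(\<eta> u)\<^sup>2 = b" using roots[OF u] by (simp_all add: a_def b_def)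
    have "(p0 + p1 * \<xi> u)\<^sup>2 = (p2 + p3 * \<xi> u)\<^sup>2 * (\<eta> u)\<^sup>2"
      using zero[OF u, folded p0_def p1_def p2_def p3_def] by Groebner_Basis.algebra
    then have "(p0\<^sup>2 + a * p1\<^sup>2 - b * (p2\<^sup>2 + a * p3\<^sup>2)) = - (2 * (p0 * p1 - b * p2 * p3)) * \<xi> u"
      using r by Groebner_Basis.algebra
    then have "(p0\<^sup>2 + a * p1\<^sup>2 - b * (p2\<^sup>2 + a * p3\<^sup>2))\<^sup>2 = a * (2 * (p0 * p1 - b * p2 * p3))\<^sup>2"
      using r(1) by Groebner_Basis.algebra
    then show "poly (M\<^sup>2 - A * N\<^sup>2) u = 0"
      by (simp add: M_def N_def p0_def p1_def p2_def p3_def a_def b_def)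
  qed
  then have MN: "M\<^sup>2 = A * N\<^sup>2" by simp
  then have N: "N = 0" using ns(1) by (auto simp: non_square_def)
  with MN have M: "M = 0" by simp
  from N have PN: "P0 * P1 = B * P2 * P3" by (simp add: N_def)
  from M have PM: "P0\<^sup>2 + A * P1\<^sup>2 = B * (P2\<^sup>2 + A * P3\<^sup>2)" by (simp add: M_def)
  \<comment> \<open>A square identity of polynomials splits into two cases, each of which exhibits one of \<open>B\<close>, \<open>A B\<close> as a
    quotient of squares unless all coefficients vanish.\<close>
  have "(P0\<^sup>2 - A * P1\<^sup>2)\<^sup>2 = (P0\<^sup>2 + A * P1\<^sup>2)\<^sup>2 - 4 * A * (P0 * P1)\<^sup>2"
    by (simp add: power2_eq_square algebra_simps)
  also have "\<dots> = (B * (P2\<^sup>2 - A * P3\<^sup>2))\<^sup>2"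
    unfolding PN PM by (simp add: power2_eq_square algebra_simps)
  finally have "P0\<^sup>2 - A * P1\<^sup>2 = B * (P2\<^sup>2 - A * P3\<^sup>2) \<or> P0\<^sup>2 - A * P1\<^sup>2 = - (B * (P2\<^sup>2 - A * P3\<^sup>2))"
    by (simp only: power2_eq_iff)
  then have "P0 = 0 \<and> P1 = 0 \<and> P2 = 0 \<and> P3 = 0"
  proof
    assume *: "P0\<^sup>2 - A * P1\<^sup>2 = B * (P2\<^sup>2 - A * P3\<^sup>2)"
    have "2 * P0\<^sup>2 = 2 * (B * P2\<^sup>2)"
      using PM * by Groebner_Basis.algebra
    then have 0: "P0\<^sup>2 = B * P2\<^sup>2" by simp
    then have P2: "P2 = 0" using ns(2) by (auto simp: non_square_def)
    with 0 have P0: "P0 = 0" by simp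
    have "A \<noteq> 0" using ns(1) by (rule non_square_nonzero)
    moreover from PM P0 P2 have "A * P1\<^sup>2 = A * (B * P3\<^sup>2)" by (simp add: mult.left_commute)
    ultimately have 1: "P1\<^sup>2 = B * P3\<^sup>2" by simp
    then have "P3 = 0" using ns(2) by (auto simp: non_square_def)
    with 1 P0 P2 show ?thesis by simp
  next
    assume *: "P0\<^sup>2 - A * P1\<^sup>2 = - (B * (P2\<^sup>2 - A * P3\<^sup>2))"
    have "2 * P0\<^sup>2 = 2 * (A * B * P3\<^sup>2)"
      using PM * by Groebner_Basis.algebra
    then have 0: "P0\<^sup>2 = A * B * P3\<^sup>2" by simp
    then have P3: "P3 = 0" using ns(3) by (auto simp: non_square_def)
    with 0 have P0: "P0 = 0" by simp
    have "A \<noteq> 0" using ns(1) by (rule non_square_nonzero)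
    from PM P0 P3 have "A * P1\<^sup>2 = B * P2\<^sup>2" by simp
    then have 1: "(A * P1)\<^sup>2 = A * B * P2\<^sup>2" by (simp add: power2_eq_square algebra_simps)
    then have "P2 = 0" using ns(3) by (auto simp: non_square_def)
    with 1 P0 P3 \<open>A \<noteq> 0\<close> show ?thesis by simp
  qed
  then show "P0 = 0" "P1 = 0" "P2 = 0" "P3 = 0" by auto
qed

text \<open>
  Along an arc of the boundary, \<open>x\<^sub>1\<^sup>2\<close> and \<open>x\<^sub>2\<^sup>2\<close>
  are polynomials in \<open>x\<^sub>0\<^sup>2\<close>. A linear term therefore cannot be cancelled by
  the quadratic terms, and functions of this form have finitely many zeros on the arc.
\<close>

definition quadratic_with_linear_part :: "(real^3 \<Rightarrow> real) \<Rightarrow> bool" where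
  "quadratic_with_linear_part g \<longleftrightarrow> (\<exists>\<alpha> l0 l1 l2 m00 m11 m22 m01 m02 m12.
     (l0 \<noteq> 0 \<or> l1 \<noteq> 0 \<or> l2 \<noteq> 0) \<and>
     (\<forall>x. g x = \<alpha> + l0 * x $ 0 + l1 * x $ 1 + l2 * x $ 2 + m00 * (x $ 0)\<^sup>2 + m11 * (x $ 1)\<^sup>2 + m22 * (x $ 2)\<^sup>2
        + m01 * x $ 0 * x $ 1 + m02 * x $ 0 * x $ 2 + m12 * x $ 1 * x $ 2))"

text \<open>
  The polynomials are \<open>\<alpha> + \<gamma> u\<^sup>2\<close> and its product with \<open>\<alpha>'
  + \<gamma>' u\<^sup>2\<close>. The third assumption says that these have no common root.
\<close>

lemma non_square_quadratic:
  fixes \<alpha> \<gamma> \<alpha>' \<gamma>' :: real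
  assumes "\<alpha> \<noteq> 0" "\<gamma> \<noteq> 0" "\<alpha>' * \<gamma> \<noteq> \<alpha> * \<gamma>'"
  shows "non_square [:of_real \<alpha>, 0, of_real \<gamma>:]"
    and "non_square ([:of_real \<alpha>, 0, of_real \<gamma>:] * [:of_real \<alpha>', 0, of_real \<gamma>':])"
proof -
  define r where "r = csqrt (of_real (- \<alpha> / \<gamma>))"
  have r2: "r * r = of_real (- \<alpha> / \<gamma>)" by (simp add: r_def power2_eq_square[symmetric])
  have r: "r \<noteq> 0" using r2 assms by auto
  have fac: "[:of_real \<alpha>, 0, of_real \<gamma>:] = [:- r, 1:] * [:of_real \<gamma> * r, of_real \<gamma>:]"
  proof -
    have "of_real \<gamma> * (r * r) = - of_real \<alpha>" using assms by (simp add: r2)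
    then show ?thesis by (simp add: mult.assoc)
  qed
  show "non_square [:of_real \<alpha>, 0, of_real \<gamma>:]"
    unfolding fac by (rule non_square_simple_root) (use assms r in auto)
  have "poly [:of_real \<alpha>', 0, of_real \<gamma>':] r = of_real \<alpha>' + of_real \<gamma>' * (r * r)"
    by simp
  also have "\<dots> = of_real (\<alpha>' + \<gamma>' * (- \<alpha> / \<gamma>))" unfolding r2 by simp
  also have "\<alpha>' + \<gamma>' * (- \<alpha> / \<gamma>) = (\<alpha>' * \<gamma> - \<alpha> * \<gamma>') / \<gamma>"
    using assms(2) by (simp add: diff_divide_distrib mult.commute)
  finally have "poly [:of_real \<alpha>', 0, of_real \<gamma>':] r = of_real ((\<alpha>' * \<gamma> - \<alpha> * \<gamma>') / \<gamma>)" .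
  moreover have "(\<alpha>' * \<gamma> - \<alpha> * \<gamma>') / \<gamma> \<noteq> 0" using assms by simp
  ultimately have "poly [:of_real \<alpha>', 0, of_real \<gamma>':] r \<noteq> 0"
    by (simp only: of_real_eq_0_iff not_False_eq_True)
  then show "non_square ([:of_real \<alpha>, 0, of_real \<gamma>:] * [:of_real \<alpha>', 0, of_real \<gamma>':])"
    unfolding fac mult.assoc
  proof (intro non_square_simple_root)
    assume *: "poly [:of_real \<alpha>', 0, of_real \<gamma>':] r \<noteq> 0"
    have "poly [:of_real \<gamma> * r, of_real \<gamma>:] r \<noteq> 0" using assms r by simp
    with * show "poly ([:of_real \<gamma> * r, of_real \<gamma>:] * [:of_real \<alpha>', 0, of_real \<gamma>':]) r \<noteq> 0"
      unfolding poly_mult by (rule no_zero_divisors[rotated])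
  qed
qed

text \<open>
  The parameter \<open>u\<close> is the time coordinate. The equations of the boundary determine the
  squares of the other two coordinates, and the assumptions on \<open>I\<close> make these nonnegative.
\<close>

lemma boundary_generic_point:
  fixes d0 d1 d2 :: real
  assumes d: "d0 \<noteq> d1" "d0 \<noteq> d2" "d1 \<noteq> d2" "d0 \<noteq> 0" "d1 \<noteq> 0" "d2 \<noteq> 0"
    and I: "infinite I"
      "\<And>u. u \<in> I \<Longrightarrow> (u\<^sup>2 * (d0 - d2) - d2) / (d1 - d2) \<ge> 0"
      "\<And>u. u \<in> I \<Longrightarrow> (u\<^sup>2 * (d0 - d1) - d1) / (d2 - d1) \<ge> 0"
    and G: "finite G" "\<And>g. g \<in> G \<Longrightarrow> quadratic_with_linear_part g"
  obtains q where "q \<in> boundary (diag_form d0 d1 d2)" "\<And>g. g \<in> G \<Longrightarrow> g q \<noteq> 0"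
proof -
  define D where "D = d1 - d2"
  have D: "D \<noteq> 0" "d1 = d2 + D" using d by (auto simp: D_def)
  define \<alpha> \<gamma> \<alpha>' \<gamma>' where "\<alpha> = - d2 / D" and "\<gamma> = (d0 - d2) / D"
    and "\<alpha>' = - (- d1) / D" and "\<gamma>' = (d1 - d0) / D"
  have split: "(U * e - h) / D = - h / D + e / D * U" for U e h :: real
    by (simp add: diff_divide_distrib)
  have A: "(u\<^sup>2 * (d0 - d2) - d2) / (d1 - d2) = \<alpha> + \<gamma> * u\<^sup>2" for u
    by (simp only: \<alpha>_def \<gamma>_def split D_def[symmetric])
  have B: "(u\<^sup>2 * (d0 - d1) - d1) / (d2 - d1) = \<alpha>' + \<gamma>' * u\<^sup>2" for u
  proof -
    have "(u\<^sup>2 * (d0 - d1) - d1) / (d2 - d1) = (- (u\<^sup>2 * (d0 - d1) - d1)) / (- (d2 - d1))"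
      by (simp only: minus_divide_divide)
    also have "- (u\<^sup>2 * (d0 - d1) - d1) = u\<^sup>2 * (d1 - d0) - (- d1)" by (simp add: algebra_simps)
    also have "- (d2 - d1) = D" by (simp add: D_def)
    finally show ?thesis by (simp only: \<alpha>'_def \<gamma>'_def split)
  qed
  have pos: "\<alpha> + \<gamma> * u\<^sup>2 \<ge> 0" "\<alpha>' + \<gamma>' * u\<^sup>2 \<ge> 0" if "u \<in> I" for u
    using I(2,3)[OF that] unfolding A B by auto
  define q :: "real \<Rightarrow> real^3" where
    "q u = (\<chi> i. if i = 0 then u else if i = 1 then sqrt (\<alpha> + \<gamma> * u\<^sup>2) else sqrt (\<alpha>' + \<gamma>' * u\<^sup>2))" for u
  have q: "q u $ 0 = u" "q u $ 1 = sqrt (\<alpha> + \<gamma> * u\<^sup>2)" "q u $ 2 = sqrt (\<alpha>' + \<gamma>' * u\<^sup>2)" for u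
    by (simp_all add: q_def)
  have sum: "\<alpha> + \<alpha>' = 1" "\<gamma> + \<gamma>' = 1" "d1 * \<alpha> + d2 * \<alpha>' = 0" "d1 * \<gamma> + d2 * \<gamma>' = d0"
  proof -
    have *: "X / D + Y / D = (X + Y) / D" "e * (X / D) + h * (Y / D) = (e * X + h * Y) / D" for X Y e h :: real
      by (simp_all add: add_divide_distrib)
    show "\<alpha> + \<alpha>' = 1" "\<gamma> + \<gamma>' = 1" "d1 * \<alpha> + d2 * \<alpha>' = 0" "d1 * \<gamma> + d2 * \<gamma>' = d0"
      using D(1) unfolding \<alpha>_def \<gamma>_def \<alpha>'_def \<gamma>'_def * by (simp_all add: D(2) algebra_simps)
  qed
  have bd: "q u \<in> boundary (diag_form d0 d1 d2)" if "u \<in> I" for u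
  proof -
    have sq: "q u $ 1 * q u $ 1 = \<alpha> + \<gamma> * u\<^sup>2" "q u $ 2 * q u $ 2 = \<alpha>' + \<gamma>' * u\<^sup>2"
      using pos[OF that] by (simp_all add: q)
    have "lorentz (q u) (q u) = (\<alpha> + \<alpha>') + (\<gamma> + \<gamma>' - 1) * u\<^sup>2"
      unfolding lorentz_def sq q(1) power2_eq_square by (simp only: ring_distribs mult_1_left diff_conv_add_uminus minus_mult_left add_ac)
    moreover have "diag_form d0 d1 d2 (q u) (q u) = (d1 * \<alpha> + d2 * \<alpha>') + (d1 * \<gamma> + d2 * \<gamma>' - d0) * u\<^sup>2"
      unfolding diag_form_def sq q(1) power2_eq_square by (simp only: ring_distribs mult.assoc diff_conv_add_uminus minus_mult_left add_ac)
    ultimately show ?thesis unfolding sum by (simp add: boundary_def)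
  qed
  have cross: "\<alpha>' * \<gamma> \<noteq> \<alpha> * \<gamma>'"
  proof
    assume "\<alpha>' * \<gamma> = \<alpha> * \<gamma>'"
    then have "\<alpha> = \<gamma>" using sum(1,2) by Groebner_Basis.algebra
    then have "\<alpha> * D = \<gamma> * D" by simp
    moreover have "\<alpha> * D = - d2" "\<gamma> * D = d0 - d2"
      using D(1) by (simp_all add: \<alpha>_def \<gamma>_def)
    ultimately have "d0 = 0" by linarith
    with d(4) show False by contradiction
  qed
  have coeffs: "\<alpha> \<noteq> 0" "\<gamma> \<noteq> 0" "\<alpha>' \<noteq> 0" "\<gamma>' \<noteq> 0"
    using d D(1) unfolding \<alpha>_def \<gamma>_def \<alpha>'_def \<gamma>'_def divide_eq_0_iff by auto
  let ?A = "[:complex_of_real \<alpha>, 0, of_real \<gamma>:]" and ?B = "[:complex_of_real \<alpha>', 0, of_real \<gamma>':]"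
  have ns: "non_square ?A" "non_square ?B" "non_square (?A * ?B)"
    using non_square_quadratic[OF coeffs(1,2) cross] non_square_quadratic(1)[OF coeffs(3,4) cross[symmetric]]
    by (simp_all only:)
  have fin: "finite {u \<in> I. g (q u) = 0}" if "quadratic_with_linear_part g" for g
  proof (rule ccontr)
    assume inf: "infinite {u \<in> I. g (q u) = 0}"
    obtain e l0 l1 l2 m00 m11 m22 m01 m02 m12 where l: "l0 \<noteq> 0 \<or> l1 \<noteq> 0 \<or> l2 \<noteq> 0"
      and g: "\<And>x. g x = e + l0 * x $ 0 + l1 * x $ 1 + l2 * x $ 2 + m00 * (x $ 0)\<^sup>2 + m11 * (x $ 1)\<^sup>2 + m22 * (x $ 2)\<^sup>2
        + m01 * x $ 0 * x $ 1 + m02 * x $ 0 * x $ 2 + m12 * x $ 1 * x $ 2"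
      using \<open>quadratic_with_linear_part g\<close> unfolding quadratic_with_linear_part_def by blast
    let ?Z = "complex_of_real ` {u \<in> I. g (q u) = 0}"
    let ?P0 = "[:complex_of_real (e + m11 * \<alpha> + m22 * \<alpha>'), of_real l0, of_real (m00 + m11 * \<gamma> + m22 * \<gamma>'):]"
    let ?P1 = "[:complex_of_real l1, of_real m01:]" and ?P2 = "[:complex_of_real l2, of_real m02:]"
    let ?P3 = "[:complex_of_real m12:]"
    let ?\<xi> = "\<lambda>u. complex_of_real (sqrt (\<alpha> + \<gamma> * (Re u)\<^sup>2))" and ?\<eta> = "\<lambda>u. complex_of_real (sqrt (\<alpha>' + \<gamma>' * (Re u)\<^sup>2))"
    have Z: "infinite ?Z"
      using inf by (subst finite_image_iff) (auto simp: inj_on_def)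
    have r: "(?\<xi> w)\<^sup>2 = poly ?A w" "(?\<eta> w)\<^sup>2 = poly ?B w" if "w \<in> ?Z" for w
    proof -
      obtain u where u: "u \<in> I" "w = of_real u" using \<open>w \<in> ?Z\<close> by auto
      have p: "poly [:complex_of_real e, 0, of_real h:] (of_real u) = of_real (e + h * u\<^sup>2)" for e h
        by (simp add: power2_eq_square)
      have "(sqrt (\<alpha> + \<gamma> * u\<^sup>2))\<^sup>2 = \<alpha> + \<gamma> * u\<^sup>2" "(sqrt (\<alpha>' + \<gamma>' * u\<^sup>2))\<^sup>2 = \<alpha>' + \<gamma>' * u\<^sup>2"
        using pos[OF u(1)] by (simp_all only: real_sqrt_pow2)
      then show "(?\<xi> w)\<^sup>2 = poly ?A w" "(?\<eta> w)\<^sup>2 = poly ?B w"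
        unfolding u(2) Re_complex_of_real of_real_power[symmetric] p by (simp_all only:)
    qed
    have "poly ?P0 w + poly ?P1 w * ?\<xi> w + poly ?P2 w * ?\<eta> w + poly ?P3 w * ?\<xi> w * ?\<eta> w = 0" if w: "w \<in> ?Z" for w
    proof -
      obtain u where u: "u \<in> I" "w = of_real u" "g (q u) = 0" using w by auto
      define a b where "a = sqrt (\<alpha> + \<gamma> * u\<^sup>2)" and "b = sqrt (\<alpha>' + \<gamma>' * u\<^sup>2)"
      have sq: "a\<^sup>2 = \<alpha> + \<gamma> * u\<^sup>2" "b\<^sup>2 = \<alpha>' + \<gamma>' * u\<^sup>2"
        using pos[OF u(1)] by (simp_all only: a_def b_def real_sqrt_pow2)
      have "g (q u) = (e + m11 * \<alpha> + m22 * \<alpha>') + u * (l0 + u * (m00 + m11 * \<gamma> + m22 * \<gamma>'))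
          + (l1 + u * m01) * a + (l2 + u * m02) * b + m12 * a * b"
        unfolding g q a_def[symmetric] b_def[symmetric] sq by (simp add: algebra_simps power2_eq_square)
      from arg_cong[OF this, of complex_of_real]
      have "poly ?P0 w + poly ?P1 w * ?\<xi> w + poly ?P2 w * ?\<eta> w + poly ?P3 w * ?\<xi> w * ?\<eta> w = of_real (g (q u))"
        unfolding u(2) Re_complex_of_real a_def[symmetric] b_def[symmetric] by simp
      then show ?thesis using u(3) by simp
    qed
    from independent_square_roots[OF ns Z r this] l show False by auto
  qed
  have "finite (\<Union>g\<in>G. {u \<in> I. g (q u) = 0})"
    using G fin by auto
  then have "infinite (I - (\<Union>g\<in>G. {u \<in> I. g (q u) = 0}))"
    using I(1) by (rule Diff_infinite_finite)
  then obtain u where u: "u \<in> I - (\<Union>g\<in>G. {u \<in> I. g (q u) = 0})"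
    using infinite_imp_nonempty by blast
  show thesis
    by (rule that[of "q u"]) (use u bd in auto)
qed


lemma quadratic_with_linear_partI:
  assumes "l0 \<noteq> 0 \<or> l1 \<noteq> 0 \<or> l2 \<noteq> 0"
    and "\<And>x. g x = \<alpha> + l0 * x $ 0 + l1 * x $ 1 + l2 * x $ 2 + m00 * (x $ 0)\<^sup>2 + m11 * (x $ 1)\<^sup>2 + m22 * (x $ 2)\<^sup>2
        + m01 * x $ 0 * x $ 1 + m02 * x $ 0 * x $ 2 + m12 * x $ 1 * x $ 2"
  shows "quadratic_with_linear_part g"
  using assms unfolding quadratic_with_linear_part_def by blast

text \<open>
  On the second and third axis \<open>K\<close> has no zero apart from the origin, and the first axis
  does not meet the hyperboloid.
\<close>

lemma boundary_not_axis:
  assumes "r \<in> boundary (diag_form d0 d1 d2)" and "d0 \<noteq> 0" "d1 \<noteq> 0" "d2 \<noteq> 0"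
  shows "r $ 1 \<noteq> 0 \<or> r $ 2 \<noteq> 0" "r $ 0 \<noteq> 0 \<or> r $ 2 \<noteq> 0" "r $ 0 \<noteq> 0 \<or> r $ 1 \<noteq> 0"
proof -
  have l: "r $ 1 * r $ 1 + r $ 2 * r $ 2 = 1 + r $ 0 * r $ 0"
    and k: "d1 * (r $ 1 * r $ 1) + d2 * (r $ 2 * r $ 2) = d0 * (r $ 0 * r $ 0)"
    using assms(1) by (simp_all add: boundary_def lorentz_def diag_form_def)
  show "r $ 1 \<noteq> 0 \<or> r $ 2 \<noteq> 0"
  proof (rule ccontr)
    assume "\<not> ?thesis"
    then have "1 + r $ 0 * r $ 0 = 0" using l by simp
    moreover have "r $ 0 * r $ 0 \<ge> 0" by simp
    ultimately show False by linarith
  qed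
  show "r $ 0 \<noteq> 0 \<or> r $ 2 \<noteq> 0" "r $ 0 \<noteq> 0 \<or> r $ 1 \<noteq> 0"
    using l k assms(2-4) by auto
qed

section \<open>Closing of alternating chord paths\<close>

text \<open>
  The factor \<open>(-1) ^ j\<close> makes consecutive chords belong to different rulings.
\<close>

definition chord_path :: "(real^3 \<Rightarrow> real^3 \<Rightarrow> real) \<Rightarrow> real \<Rightarrow> nat \<Rightarrow> (nat \<Rightarrow> real^3) \<Rightarrow> bool" where
  "chord_path K \<epsilon> n x \<longleftrightarrow> (\<forall>j\<le>n. x j \<in> boundary K) \<and> (\<forall>j<n. chord K (\<epsilon> * (-1) ^ j) (x j) (x (Suc j)))"

definition cubic :: "real \<Rightarrow> real \<Rightarrow> real \<Rightarrow> complex poly" where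
  "cubic d0 d1 d2 = [:1, - of_real d0:] * [:1, - of_real d1:] * [:1, - of_real d2:]"

context chord_frame
begin

definition z :: "real^3 \<Rightarrow> real" where "z p = K q p / (1 - lorentz q p)"

text \<open>
  The coefficient of \<open>X\<^sup>2\<close> in the quadratic polynomial of the pair of chords with
  middle point \<open>p\<close>.
\<close>

definition \<beta> :: "real^3 \<Rightarrow> real" where
  "\<beta> p = 2 * (b * c * (s p * t p - 1) + k1 * c * s p + k2 * b * t p)"

text \<open>
  The product of the leading coefficients of the equation of the curve as a quadratic in
  \<open>s\<close> and in \<open>t\<close>, up to the factor \<open>4\<close>.
\<close>

definition \<mu> :: "real^3 \<Rightarrow> real" where
  "\<mu> p = 4 * (b * t p + k1) * (c * s p + k2)"

definition double_step :: "real^3 \<Rightarrow> real^3 \<Rightarrow> real^3 \<Rightarrow> bool" where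
  "double_step p p' p'' \<longleftrightarrow> {p, p', p''} \<subseteq> boundary K \<and> (\<forall>r\<in>{p, p', p''}. lorentz q r \<noteq> 1)
     \<and> chord K \<epsilon> p p' \<and> chord K (- \<epsilon>) p' p''"

lemma double_step_identities:
  assumes "double_step p p' p''"
  shows "4 * k3\<^sup>2 + 2 * \<beta> p' - (d0 * d1 + d0 * d2 + d1 * d2) = \<mu> p'"
    and "d0 * d1 * d2 - 4 * k3 * \<beta> p' = \<mu> p' * (z p + z p'')"
    and "(\<beta> p')\<^sup>2 = \<mu> p' * z p * z p''"
    and "\<beta> p' = - 2 * b * s p * z p - 4 * k3 * b * s p + 2 * k1 * c * s p - 2 * k2 * b * t p"
    and "\<beta> p' = - 2 * c * t p'' * z p'' - 4 * k3 * c * t p'' - 2 * k1 * c * s p'' + 2 * k2 * b * t p''"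
proof -
  have bd: "p \<in> boundary K" "p' \<in> boundary K" "p'' \<in> boundary K"
    and af: "lorentz q p \<noteq> 1" "lorentz q p' \<noteq> 1" "lorentz q p'' \<noteq> 1"
    and ch: "chord K \<epsilon> p p'" "chord K (- \<epsilon>) p' p''"
    using assms by (auto simp: double_step_def)
  have l: "lorentz p p = 1" "lorentz p'' p'' = 1" using bd by (auto simp: boundary_def)
  note v = chord_vieta[OF bd(1) ch(1) af(1,2)] and v' = chord_vieta'[OF bd(2) ch(2) af(2,3)]
  have zp: "b * s p + c * t p = z p" "b * s p'' + c * t p' = z p''"
    using pencil_coordinate[OF l(1) af(1)] pencil_coordinate[OF l(2) af(3)]
    by (simp_all add: z_def v'(1))
  note st = step_identities[OF curve_equation[OF bd(2) af(2)], of "t p" "s p''",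
      folded \<beta>_def \<mu>_def, unfolded v(1) zp]
  note st = st[OF v(2) v'(2)[unfolded v(1)]]
  have b: "2 * (b * c * (s p * t p' - 1) + k1 * c * s p + k2 * b * t p') = \<beta> p'"
    and m: "4 * (b * t p' + k1) * (c * s p + k2) = \<mu> p'"
    by (simp_all add: \<beta>_def \<mu>_def v(1))
  note st = st[unfolded b m]
  show "4 * k3\<^sup>2 + 2 * \<beta> p' - (d0 * d1 + d0 * d2 + d1 * d2) = \<mu> p'"
    using st(1) symmetric_functions(2) by simp
  show "d0 * d1 * d2 - 4 * k3 * \<beta> p' = \<mu> p' * (z p + z p'')"
    using st(2) symmetric_functions(3) by simp
  show "(\<beta> p')\<^sup>2 = \<mu> p' * z p * z p''" by (rule st(3))
  show "\<beta> p' = - 2 * b * s p * z p - 4 * k3 * b * s p + 2 * k1 * c * s p - 2 * k2 * b * t p"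
    by (rule st(4))
  show "\<beta> p' = - 2 * c * t p'' * z p'' - 4 * k3 * c * t p'' - 2 * k1 * c * s p'' + 2 * k2 * b * t p''"
    using st(5) by (simp only: v'(1))
qed

text \<open>
  Consecutive steps share the end point \<open>r\<close>, where their polynomials take values belonging
  to conjugate points. So the parts of \<open>\<beta> p'\<close> and \<open>\<beta> r'\<close> that are
  odd under conjugation cancel.
\<close>

lemma beta_sum:
  assumes "double_step p p' r" "double_step r r' r''"
  shows "\<beta> p' + \<beta> r' = - 2 * z r * (z r + 2 * k3)"
proof -
  have r: "lorentz r r = 1" "lorentz q r \<noteq> 1" using assms(2) by (auto simp: double_step_def boundary_def)
  have "\<beta> p' + \<beta> r' = - 2 * (b * s r + c * t r) * (z r + 2 * k3)"
    using double_step_identities(5)[OF assms(1)] double_step_identities(4)[OF assms(2)]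
    by (simp add: algebra_simps)
  also have "b * s r + c * t r = z r"
    using pencil_coordinate[OF r] by (simp add: z_def)
  finally show ?thesis .
qed

text \<open>
  The assumptions on \<open>q\<close> hold for generic \<open>q\<close>: all points of the path have
  finite coordinates, \<open>X = -1/z\<close> is finite and unramified at the initial point, and
  \<open>z\<close> distinguishes the end points if they differ.
\<close>

lemma chord_path_closes_iff:
  fixes y :: "complex fps"
  assumes m: "m \<ge> 2"
    and y: "y\<^sup>2 = fps_of_poly (cubic d0 d1 d2)" "fps_nth y 0 = 1"
    and d: "d0 \<noteq> 0" "d1 \<noteq> 0" "d2 \<noteq> 0"
    and path: "chord_path K \<epsilon> (2 * m) x"
    and affine: "\<And>j. j \<le> 2 * m \<Longrightarrow> lorentz q (x j) \<noteq> 1"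
    and z0: "z (x 0) \<noteq> 0" "z (x 0) + d0 \<noteq> 0" "z (x 0) + d1 \<noteq> 0" "z (x 0) + d2 \<noteq> 0"
    and sep: "z (x (2 * m)) = z (x 0) \<Longrightarrow> x (2 * m) = x 0"
  shows "x (2 * m) = x 0 \<longleftrightarrow>
    (\<exists>B C. B \<noteq> 0 \<and> degree B \<le> m - 2 \<and> degree C \<le> m \<and>
       fps_X ^ (2 * m) dvd fps_of_poly C + fps_of_poly B * y)"
proof -
  define Z where "Z k = complex_of_real (z (x (2 * k)))" for k
  define B where "B k = \<beta> (x (2 * k + 1))" for k
  define M where "M k = \<mu> (x (2 * k + 1))" for k
  let ?p = "\<lambda>k. [:1, - 2 * complex_of_real k3, complex_of_real (B k):]"
  let ?a = "\<lambda>k. [:2, - 2 * (Z k + 2 * complex_of_real k3):]"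
  have bd: "x j \<in> boundary K" if "j \<le> 2 * m" for j
    using path that by (auto simp: chord_path_def)
  have ch: "chord K \<epsilon> (x (2 * k)) (x (2 * k + 1))" "chord K (- \<epsilon>) (x (2 * k + 1)) (x (2 * k + 2))" if "k < m" for k
  proof -
    have "chord K (\<epsilon> * (-1) ^ j) (x j) (x (Suc j))" if "j < 2 * m" for j
      using path that by (auto simp: chord_path_def)
    from this[of "2 * k"] this[of "2 * k + 1"] that
    show "chord K \<epsilon> (x (2 * k)) (x (2 * k + 1))" "chord K (- \<epsilon>) (x (2 * k + 1)) (x (2 * k + 2))"
      by (simp_all add: power_mult)
  qed
  have ds: "double_step (x (2 * k)) (x (2 * k + 1)) (x (2 * k + 2))" if "k < m" for k
    using that bd affine ch[OF that] by (auto simp: double_step_def)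
  have sum: "?p j + ?p k = [:1, Z k:] * ?a k" if "j < m" "k < m" "x (2 * k) = x (2 * j + 2)" for j k
  proof -
    have "B j + B k = - 2 * z (x (2 * k)) * (z (x (2 * k)) + 2 * k3)"
      unfolding B_def by (rule beta_sum[OF ds[OF that(1), folded that(3)] ds[OF that(2)]])
    from arg_cong[OF this, of complex_of_real]
    have "complex_of_real (B j) + complex_of_real (B k) = - 2 * Z k * (Z k + 2 * complex_of_real k3)"
      by (simp add: Z_def)
    then show ?thesis by (simp add: algebra_simps)
  qed
  interpret cf: sqrt_continued_fraction "cubic d0 d1 d2" y m ?p ?a Z "\<lambda>k. complex_of_real (M k)"
  proof
    show "degree (cubic d0 d1 d2) = 3"
      using d by (simp add: cubic_def)
    show "y\<^sup>2 = fps_of_poly (cubic d0 d1 d2)" "fps_nth y 0 = 1" by (fact y)+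
    show "degree (?p k) \<le> 2" "coeff (?p k) 0 = 1" "degree (?a k) \<le> 1" for k
      by (simp_all)
    show "(?p k)\<^sup>2 - cubic d0 d1 d2 =
        Polynomial.smult (complex_of_real (M k)) ([:0, 1:]\<^sup>2 * [:1, Z k:] * [:1, Z (Suc k):])" if k: "k < m" for k
    proof -
      note st = double_step_identities(1-3)[OF ds[OF k], folded M_def B_def]
      have Z: "Z (Suc k) = complex_of_real (z (x (2 * k + 2)))" by (simp add: Z_def)
      show ?thesis
        unfolding cubic_def Z unfolding Z_def
      proof (rule norm_identity)
        show "complex_of_real d0 + of_real d1 + of_real d2 = 4 * of_real k3"
          using arg_cong[OF symmetric_functions(1), of complex_of_real] by simp
        show "4 * (complex_of_real k3)\<^sup>2 + 2 * of_real (B k) -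
            (of_real d0 * of_real d1 + of_real d0 * of_real d2 + of_real d1 * of_real d2) = complex_of_real (M k)"
          using arg_cong[OF st(1), of complex_of_real] by simp
        show "of_real d0 * of_real d1 * of_real d2 - 4 * of_real k3 * complex_of_real (B k) =
            of_real (M k) * (of_real (z (x (2 * k))) + of_real (z (x (2 * k + 2))))"
          using arg_cong[OF st(2), of complex_of_real] by simp
        show "(complex_of_real (B k))\<^sup>2 = of_real (M k) * of_real (z (x (2 * k))) * of_real (z (x (2 * k + 2)))"
          using arg_cong[OF st(3), of complex_of_real] by simp
      qed
    qed
    show "?p k + ?p (Suc k) = [:1, Z (Suc k):] * ?a (Suc k)" if "Suc k < m" for k
      by (rule sum) (use that in auto)
  qed
  show ?thesis
  proof
    assume closed: "x (2 * m) = x 0"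
    show "\<exists>B C. B \<noteq> 0 \<and> degree B \<le> m - 2 \<and> degree C \<le> m \<and>
       fps_X ^ (2 * m) dvd fps_of_poly C + fps_of_poly B * y"
    proof (rule cf.closed_imp_approximant[OF m])
      show "Z m = Z 0" "Z 0 \<noteq> 0" using closed z0 by (simp_all add: Z_def)
      have "1 + d / z (x 0) \<noteq> 0" if "z (x 0) + d \<noteq> 0" for d :: real
        using that z0(1) by (simp add: field_simps)
      then have "complex_of_real (1 + d / z (x 0)) \<noteq> 0" if "z (x 0) + d \<noteq> 0" for d :: real
        using that by (simp only: of_real_eq_0_iff)
      from this[OF z0(2)] this[OF z0(3)] this[OF z0(4)]
      show "poly (cubic d0 d1 d2) (- 1 / Z 0) \<noteq> 0"
        unfolding cubic_def poly_mult mult_eq_0_iff by (simp add: Z_def)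
      have "2 * (m - 1) + 2 = 2 * m" using m by simp
      then have "?p (m - 1) + ?p 0 = [:1, Z 0:] * ?a 0"
        using m closed by (intro sum) simp_all
      then show "[:1, Z 0:] dvd ?p (m - 1) + ?p 0" by (simp only: dvd_triv_left)
    qed
  next
    assume "\<exists>B C. B \<noteq> 0 \<and> degree B \<le> m - 2 \<and> degree C \<le> m \<and>
       fps_X ^ (2 * m) dvd fps_of_poly C + fps_of_poly B * y"
    then have "Z m = Z 0" using cf.approximant_imp_closed[OF m] by blast
    then show "x (2 * m) = x 0" by (intro sep) (simp add: Z_def)
  qed
qed

end

text \<open>
  Each requirement on \<open>q\<close> in \<open>chord_path_closes_iff\<close> is the non-vanishing of a
  polynomial function of \<open>q\<close> of degree at most two that has a nonzero linear part.
\<close>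

lemma chord_path_closes_iff_hankel:
  fixes y :: "complex fps" and d0 d1 d2 :: real
  defines "K \<equiv> diag_form d0 d1 d2"
  assumes m: "m \<ge> 2"
    and d: "d0 \<noteq> d1" "d0 \<noteq> d2" "d1 \<noteq> d2" "d0 \<noteq> 0" "d1 \<noteq> 0" "d2 \<noteq> 0"
    and I: "infinite I"
      "\<And>u. u \<in> I \<Longrightarrow> (u\<^sup>2 * (d0 - d2) - d2) / (d1 - d2) \<ge> 0"
      "\<And>u. u \<in> I \<Longrightarrow> (u\<^sup>2 * (d0 - d1) - d1) / (d2 - d1) \<ge> 0"
    and y: "y\<^sup>2 = fps_of_poly (cubic d0 d1 d2)" "fps_nth y 0 = 1"
    and \<epsilon>: "\<epsilon> * \<epsilon> = 1" and path: "chord_path K \<epsilon> (2 * m) x"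
  shows "x (2 * m) = x 0 \<longleftrightarrow>
    Determinant.det (Matrix.mat (m - 1) (m - 1) (\<lambda>(i, j). fps_nth y (i + j + 3))) = 0"
proof -
  define r r' where "r = x 0" and "r' = x (2 * m)"
  have bd: "x j \<in> boundary K" if "j \<le> 2 * m" for j
    using path that by (simp add: chord_path_def)
  then have r: "r \<in> boundary K" "r' \<in> boundary K" by (simp_all add: r_def r'_def)
  define G where "G = (\<lambda>j q. 1 - lorentz q (x j)) ` {..2 * m} \<union> {\<lambda>q. K q r}
    \<union> (\<lambda>d q. K q r + d * (1 - lorentz q r)) ` {d0, d1, d2}
    \<union> (if r' = r then {} else {\<lambda>q. K q r' * (1 - lorentz q r) - K q r * (1 - lorentz q r')})"
  have "finite G" by (simp add: G_def)
  moreover have "quadratic_with_linear_part g" if g: "g \<in> G" for g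
  proof -
    have 1: "quadratic_with_linear_part (\<lambda>q. 1 - lorentz q (x j))" if "j \<le> 2 * m" for j
      by (rule quadratic_with_linear_partI[of "x j $ 0" "- x j $ 1" "- x j $ 2" _ 1 0 0 0 0 0 0])
        (use boundary_not_axis(1)[OF bd[OF that, unfolded K_def] d(4-6)] in \<open>auto simp: lorentz_def mult.commute\<close>)
    have 2: "quadratic_with_linear_part (\<lambda>q. K q r)"
      by (rule quadratic_with_linear_partI[of "- d0 * r $ 0" "d1 * r $ 1" "d2 * r $ 2" _ 0 0 0 0 0 0 0])
        (use boundary_not_axis(1)[OF r(1)[unfolded K_def] d(4-6)] d in \<open>auto simp: K_def diag_form_def mult_ac\<close>)
    have 3: "quadratic_with_linear_part (\<lambda>q. K q r + e * (1 - lorentz q r))" if "e \<in> {d0, d1, d2}" for e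
      by (rule quadratic_with_linear_partI[of "(e - d0) * r $ 0" "(d1 - e) * r $ 1" "(d2 - e) * r $ 2" _ e 0 0 0 0 0 0])
        (use boundary_not_axis[OF r(1)[unfolded K_def] d(4-6)] d that in
          \<open>auto simp: K_def diag_form_def lorentz_def algebra_simps\<close>)
    \<comment> \<open>The linear part is \<open>q \<mapsto> K q (r' - r)\<close>.\<close>
    have 4: "quadratic_with_linear_part (\<lambda>q. K q r' * (1 - lorentz q r) - K q r * (1 - lorentz q r'))" if "r' \<noteq> r"
    proof (rule quadratic_with_linear_partI[of "- d0 * (r' $ 0 - r $ 0)" "d1 * (r' $ 1 - r $ 1)" "d2 * (r' $ 2 - r $ 2)" _ 0
          0 0 0
          "d0 * r' $ 0 * r $ 1 + d1 * r' $ 1 * r $ 0 - d0 * r $ 0 * r' $ 1 - d1 * r $ 1 * r' $ 0"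
          "d0 * r' $ 0 * r $ 2 + d2 * r' $ 2 * r $ 0 - d0 * r $ 0 * r' $ 2 - d2 * r $ 2 * r' $ 0"
          "- d1 * r' $ 1 * r $ 2 - d2 * r' $ 2 * r $ 1 + d1 * r $ 1 * r' $ 2 + d2 * r $ 2 * r' $ 1"])
      show "- d0 * (r' $ 0 - r $ 0) \<noteq> 0 \<or> d1 * (r' $ 1 - r $ 1) \<noteq> 0 \<or> d2 * (r' $ 2 - r $ 2) \<noteq> 0"
        using that d by (auto simp: vec3_eq_iff)
    qed (simp add: K_def diag_form_def lorentz_def algebra_simps power2_eq_square)
    show ?thesis using g 1 2 3 4 by (auto simp: G_def split: if_splits)
  qed
  ultimately obtain q where q: "q \<in> boundary K" and gen: "\<And>g. g \<in> G \<Longrightarrow> g q \<noteq> 0"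
    using boundary_generic_point[OF d I, of G] unfolding K_def by metis
  have affine: "lorentz q (x j) \<noteq> 1" if "j \<le> 2 * m" for j
    using gen[of "\<lambda>q. 1 - lorentz q (x j)"] that by (auto simp: G_def)
  have ra: "1 - lorentz q r \<noteq> 0" "1 - lorentz q r' \<noteq> 0"
    using affine[of 0] affine[of "2 * m"] by (simp_all add: r_def r'_def)
  have Kr: "K q r \<noteq> 0" using gen[of "\<lambda>q. K q r"] by (simp add: G_def)
  have Kd: "K q r + e * (1 - lorentz q r) \<noteq> 0" if "e \<in> {d0, d1, d2}" for e
  proof -
    have "(\<lambda>q. K q r + e * (1 - lorentz q r)) \<in> G" using that unfolding G_def by blast
    from gen[OF this] show ?thesis .
  qed
  have K4: "r' = r" if "K q r' * (1 - lorentz q r) = K q r * (1 - lorentz q r')"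
  proof (rule ccontr)
    assume "r' \<noteq> r"
    then have "(\<lambda>q. K q r' * (1 - lorentz q r) - K q r * (1 - lorentz q r')) \<in> G"
      unfolding G_def by simp
    from gen[OF this] that show False by simp
  qed
  have qq: "lorentz q q = 1" "K q q = 0" using q by (simp_all add: boundary_def)
  obtain v w where frame: "null_frame \<epsilon> q v w"
    using null_frame_exists[OF qq(1) \<epsilon>] by blast
  interpret chord_frame \<epsilon> q v w d0 d1 d2
    using frame qq(2) by (simp add: chord_frame_def chord_frame_axioms_def K_def)
  have zd: "z r + e \<noteq> 0" if "e \<in> {d0, d1, d2}" for e
  proof -
    have "z r + e = (K q r + e * (1 - lorentz q r)) / (1 - lorentz q r)"
      using ra by (simp add: z_def K_def add_divide_distrib)
    then show ?thesis using Kd[OF that] ra by simp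
  qed
  have "x (2 * m) = x 0 \<longleftrightarrow> (\<exists>B C. B \<noteq> 0 \<and> degree B \<le> m - 2 \<and> degree C \<le> m \<and>
       fps_X ^ (2 * m) dvd fps_of_poly C + fps_of_poly B * y)"
  proof (rule chord_path_closes_iff[OF m y d(4-6)])
    show "chord_path (diag_form d0 d1 d2) \<epsilon> (2 * m) x" using path by (simp add: K_def)
    show "z (x 0) \<noteq> 0" using Kr ra by (simp add: z_def K_def r_def)
    show "z (x 0) + d0 \<noteq> 0" "z (x 0) + d1 \<noteq> 0" "z (x 0) + d2 \<noteq> 0"
      using zd by (simp_all add: r_def)
    show "x (2 * m) = x 0" if "z (x (2 * m)) = z (x 0)"
    proof -
      have "K q r' / (1 - lorentz q r') = K q r / (1 - lorentz q r)"
        using that by (simp add: z_def K_def r_def r'_def)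
      then have "K q r' * (1 - lorentz q r) = K q r * (1 - lorentz q r')"
        by (simp only: frac_eq_eq[OF ra(2) ra(1)])
      then show ?thesis using K4 by (simp add: r_def r'_def)
    qed
  qed (use affine in auto)
  then show ?thesis unfolding hankel_det_eq_0_iff[OF m] .
qed

section \<open>The billiard\<close>

lemma null_direction_along: "null_direction \<epsilon> p u \<Longrightarrow> null_direction \<epsilon> (p + \<tau> *\<^sub>R u) u"
  by (simp add: null_direction_def)

lemma null_direction_scale:
  "null_direction \<epsilon> p u \<Longrightarrow> c \<noteq> 0 \<Longrightarrow> null_direction \<epsilon> p (c *\<^sub>R u)"
  by (simp add: null_direction_def)

lemma null_direction_light_like:
  assumes "lorentz p p = 1" "v \<in> tangent_space p" "light_like v"
  shows "null_direction 1 p v \<or> null_direction (-1) p v"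
  using assms by (intro null_direction_cases) (auto simp: tangent_space_def light_like_def)

text \<open>
  The collared and the transverse billiard obey the same local rules; they differ in the position of the
  boundary curve, see \<open>boundary_arc\<close>.
\<close>

locale light_like_billiard =
  fixes a0 a1 a2 :: real and D :: "(real^3) set" and p v :: "nat \<Rightarrow> real^3"
  assumes nz: "a0 \<noteq> 0" "a1 \<noteq> 0" "a2 \<noteq> 0"
    and D: "D \<subseteq> hyperboloid"
    and trajectory: "light_like_trajectory (diag3 a0 a1 a2) D p v"
begin

abbreviation A where "A \<equiv> diag3 a0 a1 a2"
abbreviation K where "K \<equiv> diag_form (1 / a0) (1 / a1) (1 / a2)"

lemma lorentz_normal_vec: "lorentz (normal_vec A x) y = K x y" "lorentz y (normal_vec A x) = K x y"
  using nz by (simp_all add: lorentz_def diag_form_def normal_vec_diag3 mult.commute)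

lemma boundary_curve_iff: "x \<in> boundary_curve A D \<longleftrightarrow> x \<in> D \<and> K x x = 0"
  by (simp add: boundary_curve_def lorentz_normal_vec)

lemma p_boundary: "p k \<in> boundary K"
  using trajectory D by (auto simp: light_like_trajectory_def boundary_curve_iff boundary_def hyperboloid_def)

lemma p_unit: "lorentz (p k) (p k) = 1"
  using p_boundary by (simp add: boundary_def)

lemma v_tangent: "v k \<in> tangent_space (p k)" "light_like (v k)"
  using trajectory by (auto simp: light_like_trajectory_def)

lemma v_next: "v (Suc k) = reflect A (p (Suc k)) (v k)"
  using trajectory by (auto simp: light_like_trajectory_def)

text \<open>
  If the velocity were orthogonal to the normal, the restriction of \<open>K\<close> to the line of
  flight would have a double root at \<open>p k\<close> and another root at \<open>p (Suc k)\<close>.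
  The whole segment would then belong to the boundary.
\<close>

lemma flight:
  obtains \<tau> where "\<tau> > 0" "p (Suc k) = p k + \<tau> *\<^sub>R v k" "2 * K (p k) (v k) + \<tau> * K (v k) (v k) = 0"
    "K (p k) (v k) \<noteq> 0"
proof -
  obtain \<tau> where \<tau>: "\<tau> > 0" "p (Suc k) = p k + \<tau> *\<^sub>R v k"
    "\<And>s. s \<in> {0<..<\<tau>} \<Longrightarrow> p k + s *\<^sub>R v k \<in> D - boundary_curve A D"
    using trajectory unfolding light_like_trajectory_def by blast
  have line: "K (p k + s *\<^sub>R v k) (p k + s *\<^sub>R v k) = s * (2 * K (p k) (v k) + s * K (v k) (v k))" for s
    using p_boundary[of k] by (simp add: boundary_def diag_form_commute[of _ _ _ "v k" "p k"] algebra_simps)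
  have "K (p (Suc k)) (p (Suc k)) = 0"
    using p_boundary[of "Suc k"] by (simp add: boundary_def)
  then have chord: "2 * K (p k) (v k) + \<tau> * K (v k) (v k) = 0"
    using \<tau>(1) unfolding \<tau>(2) line by simp
  have "K (p k) (v k) \<noteq> 0"
  proof
    assume 0: "K (p k) (v k) = 0"
    with chord \<tau>(1) have "K (v k) (v k) = 0" by simp
    with 0 have "K (p k + (\<tau> / 2) *\<^sub>R v k) (p k + (\<tau> / 2) *\<^sub>R v k) = 0" unfolding line by simp
    moreover have "p k + (\<tau> / 2) *\<^sub>R v k \<in> D - boundary_curve A D"
      by (rule \<tau>(3)) (use \<tau>(1) in simp)
    ultimately show False by (simp add: boundary_curve_iff)
  qed
  with \<tau> chord show thesis by (intro that)
qed

lemma not_null_along_boundary: "K (p k) (v k) \<noteq> 0"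
  by (rule flight)

lemma incoming: "K (p (Suc k)) (v k) = - K (p k) (v k)"
proof -
  obtain \<tau> where "p (Suc k) = p k + \<tau> *\<^sub>R v k" "2 * K (p k) (v k) + \<tau> * K (v k) (v k) = 0"
    by (rule flight)
  then show ?thesis by simp
qed

lemma tangent_direction:
  assumes "light_like_tangent A (p k)"
  obtains \<eta> w where "\<bar>\<eta>\<bar> = 1" "null_direction \<eta> (p k) w" "K (p k) w = 0"
proof -
  obtain w where "w \<in> tangent_space (p k)" "light_like w" "lorentz w (normal_vec A (p k)) = 0"
    using assms by (auto simp: light_like_tangent_def)
  then show thesis
    using null_direction_light_like[OF p_unit, of w k] that[of 1 w] that[of "-1" w]
    by (auto simp: lorentz_normal_vec)
qed

text \<open>
  Two light-like directions of the same ruling are proportional.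
\<close>

lemma transverse_to_tangent:
  assumes "null_direction \<epsilon> (p k) u" "K (p k) u \<noteq> 0" "\<bar>\<epsilon>\<bar> = 1"
    and "null_direction \<eta> (p k) w" "K (p k) w = 0" "\<bar>\<eta>\<bar> = 1"
  shows "\<eta> = - \<epsilon>"
proof -
  have "\<eta> \<noteq> \<epsilon>"
  proof
    assume "\<eta> = \<epsilon>"
    then obtain c where "u = c *\<^sub>R w"
      using null_direction_unique[of \<epsilon> "p k" w u] assms by auto
    with assms(2,5) show False by simp
  qed
  with assms(3,6) show ?thesis by (auto simp: abs_if split: if_splits)
qed

text \<open>
  At a point with light-like tangent, the line of the other ruling touches the boundary. It is a chord
  whose end points coincide.
\<close>

lemma tangent_chord:
  assumes "light_like_tangent A (p k)" "null_direction \<epsilon> (p k) u" "K (p k) u \<noteq> 0" "\<bar>\<epsilon>\<bar> = 1"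
  shows "chord K (- \<epsilon>) (p k) (p k)"
proof -
  obtain \<eta> w where w: "\<bar>\<eta>\<bar> = 1" "null_direction \<eta> (p k) w" "K (p k) w = 0"
    using assms(1) by (rule tangent_direction)
  have "\<eta> = - \<epsilon>" using transverse_to_tangent[OF assms(2-4) w(2,3,1)] .
  then show ?thesis
    using w unfolding chord_def by (intro exI[of _ w] exI[of _ 0]) simp
qed

lemma flight_chord:
  assumes "null_direction \<epsilon> (p k) (v k)"
  shows "chord K \<epsilon> (p k) (p (Suc k))"
proof -
  obtain \<tau> where "p (Suc k) = p k + \<tau> *\<^sub>R v k" "2 * K (p k) (v k) + \<tau> * K (v k) (v k) = 0"
    by (rule flight)
  then show ?thesis using assms unfolding chord_def by blast
qed

text \<open>
  Between two points of the cone the value changes its sign, and so it does under reflection. The usual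
  formula for the reflection applies only if the normal is not light-like; a light-like normal would
  itself be a light-like tangent vector.
\<close>

lemma joachimsthal: "K (p (Suc k)) (v (Suc k)) = K (p k) (v k)"
proof (cases "light_like_tangent A (p (Suc k))")
  case True
  then have "v (Suc k) = - v k" unfolding v_next by (simp add: reflect_def)
  then show ?thesis using incoming[of k] by simp
next
  case False
  let ?n = "normal_vec A (p (Suc k))"
  have nn: "lorentz ?n ?n \<noteq> 0"
  proof
    assume 0: "lorentz ?n ?n = 0"
    have "?n \<noteq> 0"
    proof
      assume "?n = 0"
      then have "lorentz (v k) ?n = 0" by (simp add: lorentz_def)
      then show False using incoming[of k] not_null_along_boundary[of k] by (simp add: lorentz_normal_vec)
    qed
    moreover have "lorentz ?n (p (Suc k)) = 0"
      using p_boundary[of "Suc k"] by (simp add: lorentz_normal_vec boundary_def)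
    ultimately have "light_like_tangent A (p (Suc k))"
      using 0 unfolding light_like_tangent_def by (intro bexI[of _ ?n]) (auto simp: tangent_space_def light_like_def)
    with False show False by contradiction
  qed
  have "lorentz (v (Suc k)) ?n = - lorentz (v k) ?n"
    unfolding v_next using False nn by (simp add: reflect_def Let_def)
  then show ?thesis using incoming[of k] by (simp add: lorentz_normal_vec)
qed

lemma joachimsthal_const: "K (p k) (v k) = K (p 0) (v 0)"
  by (induction k) (simp_all add: joachimsthal)

text \<open>
  At an ordinary point the new velocity belongs to the other ruling. Otherwise it would be a multiple of
  \<open>v k\<close>, and the sign change behind \<open>joachimsthal\<close> would make it \<open>- v
  k\<close>; the normal would then be proportional to the light-like vector \<open>v k\<close>, hence
  orthogonal to it, and the reflection would not change \<open>v k\<close> at all. At a point with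
  light-like tangent the particle returns along the same line, which agrees with a double count.
\<close>

lemma turn:
  assumes "null_direction \<epsilon> (p k) (v k)" "\<bar>\<epsilon>\<bar> = 1"
  shows "null_direction (\<epsilon> * (-1) ^ reflection_count A (p (Suc k))) (p (Suc k)) (v (Suc k))"
proof -
  obtain \<tau> where "p (Suc k) = p k + \<tau> *\<^sub>R v k"
    by (rule flight)
  then have inc: "null_direction \<epsilon> (p (Suc k)) (v k)"
    using null_direction_along[OF assms(1)] by simp
  show ?thesis
  proof (cases "light_like_tangent A (p (Suc k))")
    case True
    then have "v (Suc k) = (- 1) *\<^sub>R v k" unfolding v_next by (simp add: reflect_def)
    then show ?thesis using True null_direction_scale[OF inc, of "- 1"] by (simp add: reflection_count_def)
  next
    case False
    let ?n = "normal_vec A (p (Suc k))"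
    define c where "c = 2 * lorentz (v k) ?n / lorentz ?n ?n"
    have v: "v (Suc k) = v k - c *\<^sub>R ?n" unfolding v_next using False by (simp add: reflect_def c_def Let_def)
    have "\<not> null_direction \<epsilon> (p (Suc k)) (v (Suc k))"
    proof
      assume "null_direction \<epsilon> (p (Suc k)) (v (Suc k))"
      then obtain e where e: "v (Suc k) = e *\<^sub>R v k"
        using null_direction_unique[OF inc _ assms(2)] by metis
      have J: "K (p (Suc k)) (v (Suc k)) = - K (p (Suc k)) (v k)"
        using joachimsthal[of k] incoming[of k] by simp
      then have "(e + 1) * K (p (Suc k)) (v k) = 0" by (simp add: e algebra_simps)
      then have e1: "e = - 1" using incoming[of k] not_null_along_boundary[of k] by simp
      then have n: "c *\<^sub>R ?n = 2 *\<^sub>R v k" using v e by (simp add: scaleR_2 algebra_simps)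
      have "v k \<noteq> 0" using v_tangent(2)[of k] by (simp add: light_like_def)
      then have "c \<noteq> 0" using n by auto
      have "lorentz (v k) (c *\<^sub>R ?n) = 0"
        unfolding n using v_tangent(2)[of k] by (simp add: light_like_def)
      then have "lorentz (v k) ?n = 0" using \<open>c \<noteq> 0\<close> by simp
      then show False using \<open>c \<noteq> 0\<close> by (simp add: c_def)
    qed
    moreover have "\<epsilon> = 1 \<or> \<epsilon> = -1" using assms(2) by (auto simp: abs_if split: if_splits)
    ultimately show ?thesis
      using False null_direction_light_like[OF p_unit v_tangent, of "Suc k"] by (auto simp: reflection_count_def)
  qed
qed

definition reflections :: "nat \<Rightarrow> nat" where
  "reflections n = (\<Sum>i=1..n. reflection_count A (p i))"

lemma reflections_Suc: "reflections (Suc n) = reflections n + reflection_count A (p (Suc n))"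
  by (simp add: reflections_def)

lemma reflections_0 [simp]: "reflections 0 = 0"
  by (simp add: reflections_def)

lemma strict_mono_reflections: "strict_mono reflections"
  by (rule strict_monoI_Suc) (simp add: reflections_Suc reflection_count_def)

lemma family:
  assumes "null_direction \<epsilon> (p 0) (v 0)" "\<bar>\<epsilon>\<bar> = 1"
  shows "null_direction (\<epsilon> * (-1) ^ reflections k) (p k) (v k)"
proof (induction k)
  case (Suc k)
  have "\<bar>\<epsilon> * (-1) ^ reflections k\<bar> = 1" using assms(2) by (simp add: abs_mult power_abs)
  from turn[OF Suc.IH this] show ?case by (simp add: reflections_Suc power_add mult.assoc)
qed (use assms in simp)

lemma chord_path_extend:
  assumes "chord_path K \<epsilon> n x" "chord K (\<epsilon> * (-1) ^ n) (x n) b" "b \<in> boundary K"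
  obtains x' where "chord_path K \<epsilon> (Suc n) x'" "x' 0 = x 0" "x' (Suc n) = b"
proof (rule that)
  show "chord_path K \<epsilon> (Suc n) (x(Suc n := b))"
    using assms by (auto simp: chord_path_def less_Suc_eq)
qed simp_all

text \<open>
  The algebraic path repeats every point with light-like tangent, in accordance with the counting of
  reflections. A prefix of given length may end between the two copies; this is the second case.
\<close>

lemma trajectory_chord_path:
  assumes fam: "null_direction \<epsilon> (p 0) (v 0)" "\<bar>\<epsilon>\<bar> = 1"
  obtains x k where "chord_path K \<epsilon> n x" "x 0 = p 0" "x n = p k"
    "reflections k = n \<or> reflections k = Suc n \<and> light_like_tangent A (p k)"
proof -
  have "\<exists>x k. chord_path K \<epsilon> n x \<and> x 0 = p 0 \<and> x n = p k \<and>
    (reflections k = n \<or> reflections k = Suc n \<and> light_like_tangent A (p k))"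
  proof (induction n)
    case 0
    show ?case
      by (intro exI[of _ "\<lambda>_. p 0"] exI[of _ 0]) (simp add: chord_path_def p_boundary)
  next
    case (Suc n)
    then obtain x k where x: "chord_path K \<epsilon> n x" "x 0 = p 0" "x n = p k"
      and k: "reflections k = n \<or> reflections k = Suc n \<and> light_like_tangent A (p k)" by blast
    note f = family[OF fam, of k]
    have abs: "\<bar>\<epsilon> * (-1) ^ reflections k\<bar> = 1" using assms(2) by (simp add: abs_mult power_abs)
    from k show ?case
    proof
      assume n: "reflections k = n"
      have "chord K (\<epsilon> * (-1) ^ n) (x n) (p (Suc k))"
        using flight_chord[OF f] by (simp add: n x(3))
      then obtain x' where "chord_path K \<epsilon> (Suc n) x'" "x' 0 = x 0" "x' (Suc n) = p (Suc k)"
        using p_boundary by (rule chord_path_extend[OF x(1)])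
      moreover have "reflections (Suc k) = Suc n \<or> reflections (Suc k) = Suc (Suc n) \<and> light_like_tangent A (p (Suc k))"
        by (simp add: reflections_Suc n reflection_count_def)
      ultimately show ?case
        using x(2) by metis
    next
      assume n: "reflections k = Suc n \<and> light_like_tangent A (p k)"
      have "chord K (\<epsilon> * (-1) ^ n) (x n) (p k)"
        using tangent_chord[OF _ f not_null_along_boundary abs] n by (simp add: x(3))
      then obtain x' where "chord_path K \<epsilon> (Suc n) x'" "x' 0 = x 0" "x' (Suc n) = p k"
        using p_boundary by (rule chord_path_extend[OF x(1)])
      with n x(2) show ?case by metis
    qed
  qed
  then show thesis using that by blast
qed

text \<open>
  If the path returns to \<open>p 0\<close> with an even number of chords, the particle leaves along a
  line of the initial ruling, and \<open>joachimsthal_const\<close> fixes the length of the velocity.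
  The path cannot end between the two copies of a point with light-like tangent: there the initial
  velocity and the present one belong to different rulings, but both are transverse to the tangent.
\<close>

lemma periodic_iff:
  assumes fam: "null_direction \<epsilon> (p 0) (v 0)" "\<bar>\<epsilon>\<bar> = 1" and n: "n > 0" "even n"
    and x: "x 0 = p 0" "x n = p k" and k: "reflections k = n \<or> reflections k = Suc n \<and> light_like_tangent A (p k)"
  shows "periodic_trajectory A p v n \<longleftrightarrow> x n = x 0"
proof
  assume "periodic_trajectory A p v n"
  then obtain N where N: "p N = p 0" "reflections N = n"
    by (auto simp: periodic_trajectory_def reflections_def)
  from k have "k = N"
  proof
    assume "reflections k = n"
    then show ?thesis using N(2) strict_mono_eq[OF strict_mono_reflections, of k N] by simp
  next
    assume *: "reflections k = Suc n \<and> light_like_tangent A (p k)"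
    then have "N < k" using N(2) strict_mono_less[OF strict_mono_reflections, of N k] by simp
    then obtain j where j: "k = Suc j" "N \<le> j" by (cases k) auto
    then have "reflections j \<ge> n" using N(2) strict_mono_less_eq[OF strict_mono_reflections, of N j] by simp
    with * show ?thesis by (auto simp: j(1) reflections_Suc reflection_count_def)
  qed
  then show "x n = x 0" using N x by simp
next
  assume "x n = x 0"
  then have pk: "p k = p 0" using x by simp
  from k show "periodic_trajectory A p v n"
  proof
    assume c: "reflections k = n"
    have "null_direction \<epsilon> (p 0) (v k)"
      using family[OF fam, of k] n(2) by (simp add: c pk)
    then obtain e where e: "v k = e *\<^sub>R v 0"
      using null_direction_unique[OF fam(1) _ fam(2)] by metis
    have "e * K (p 0) (v 0) = K (p 0) (v 0)"
      using joachimsthal_const[of k] by (simp add: pk e)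
    then have "e = 1" using not_null_along_boundary[of 0] by simp
    then have "v k = v 0" using e by simp
    moreover have "k > 0" using c n(1) by (cases k) auto
    ultimately show ?thesis
      using pk c unfolding periodic_trajectory_def reflections_def by blast
  next
    assume c: "reflections k = Suc n \<and> light_like_tangent A (p k)"
    then obtain \<eta> w where w: "\<bar>\<eta>\<bar> = 1" "null_direction \<eta> (p k) w" "K (p k) w = 0"
      using tangent_direction by blast
    have "null_direction (- \<epsilon>) (p k) (v k)"
      using family[OF fam, of k] n(2) c by simp
    then have "\<eta> = - (- \<epsilon>)"
      using transverse_to_tangent[OF _ not_null_along_boundary _ w(2,3,1)] fam(2) by simp
    moreover have "\<eta> = - \<epsilon>"
      using transverse_to_tangent[OF fam(1) not_null_along_boundary fam(2) _ _ w(1)] w by (simp add: pk)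
    ultimately show ?thesis using fam(2) by simp
  qed
qed

end

section \<open>Periodic trajectories and the Hankel determinant\<close>

text \<open>
  This passes from the given branch of the root, whose value at \<open>0\<close> need not be real, to
  the branch with value \<open>1\<close>.
\<close>

lemma hankel_det_scale:
  fixes y :: "'a::field fps"
  assumes "c \<noteq> 0"
  shows "Determinant.det (Matrix.mat n n (\<lambda>(i, j). fps_nth (fps_const c * y) (i + j + 3))) = 0 \<longleftrightarrow>
    Determinant.det (Matrix.mat n n (\<lambda>(i, j). fps_nth y (i + j + 3))) = 0"
  unfolding det_eq_0_iff_kernel using assms by (simp add: mult.assoc sum_distrib_left[symmetric])

text \<open>
  The constant is \<open>c = f 0\<close>, and \<open>c\<^sup>2 = - sgn a1 a0 a1 a2\<close> is not zero.
\<close>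

lemma normalized_root_expansion:
  fixes a0 a1 a2 r :: real and f :: "complex \<Rightarrow> complex"
  assumes nz: "a0 \<noteq> 0" "a1 \<noteq> 0" "a2 \<noteq> 0" and "r > 0" "f holomorphic_on ball 0 r"
    and f: "\<And>X. X \<in> ball 0 r \<Longrightarrow>
           (f X)\<^sup>2 = of_real (sgn a1) * (X - of_real a0) * (X - of_real a1) * (X - of_real a2)"
  obtains c y where "c \<noteq> 0" "fps_expansion f 0 = fps_const c * y" "fps_nth y 0 = 1"
    "y\<^sup>2 = fps_of_poly (cubic (1 / a0) (1 / a1) (1 / a2))"
proof -
  define E where "E = fps_expansion f 0"
  define P where "P = Polynomial.smult (complex_of_real (sgn a1)) ([:- of_real a0, 1:] * [:- of_real a1, 1:] * [:- of_real a2, 1:])"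
  have E: "f has_fps_expansion E"
    unfolding E_def by (rule has_fps_expansion_fps_expansion[of "ball 0 r"]) (use assms in auto)
  have E2: "(\<lambda>X. f X * f X) has_fps_expansion E * E"
    by (intro has_fps_expansion_mult E)
  have P: "poly P has_fps_expansion fps_of_poly P"
    by (simp add: has_fps_expansion_def)
  have "eventually (\<lambda>X. X \<in> ball 0 r) (nhds (0 :: complex))"
    using assms(4) by (intro eventually_nhds_in_open) auto
  then have "eventually (\<lambda>X. f X * f X = poly P X) (nhds 0)"
    by eventually_elim (use f in \<open>simp add: P_def power2_eq_square algebra_simps\<close>)
  then have "poly P has_fps_expansion E * E"
    using E2 has_fps_expansion_cong by fast
  with P have EE: "E * E = fps_of_poly P"
    by (metis fps_expansion_unique_complex)
  define k where "k = - complex_of_real (sgn a1 * a0 * a1 * a2)"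
  have "k \<noteq> 0" using nz by (simp add: k_def sgn_zero_iff)
  have lin: "[:- complex_of_real a, 1:] = Polynomial.smult (- of_real a) [:1, - of_real (1 / a):]" if "a \<noteq> 0" for a
    using that by simp
  have P_cubic: "P = Polynomial.smult k (cubic (1 / a0) (1 / a1) (1 / a2))"
    unfolding P_def lin[OF nz(1)] lin[OF nz(2)] lin[OF nz(3)] cubic_def mult_smult_left mult_smult_right smult_smult
    by (simp only: k_def of_real_mult) (simp add: mult_ac)
  define c where "c = fps_nth E 0"
  have "c * c = fps_nth (E * E) 0" by (simp add: c_def fps_mult_nth)
  also have "\<dots> = k" unfolding EE P_cubic by (simp add: cubic_def)
  finally have c2: "c * c = k" .
  then have c: "c \<noteq> 0" using \<open>k \<noteq> 0\<close> by auto
  define y where "y = fps_const (1 / c) * E"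
  have "y\<^sup>2 = fps_const (1 / k) * (E * E)"
    using c by (simp add: y_def power2_eq_square c2[symmetric] mult_ac)
  also have "\<dots> = fps_of_poly (cubic (1 / a0) (1 / a1) (1 / a2))"
    unfolding EE P_cubic fps_of_poly_smult using \<open>k \<noteq> 0\<close> by (simp add: mult.assoc[symmetric])
  finally have "y\<^sup>2 = fps_of_poly (cubic (1 / a0) (1 / a1) (1 / a2))" .
  moreover have "E = fps_const c * y" "fps_nth y 0 = 1"
    using c by (simp_all add: y_def mult.assoc[symmetric] c_def)
  ultimately show thesis using that c unfolding E_def by blast
qed

text \<open>
  In the collared case the time coordinate of a boundary point is bounded away from \<open>0\<close> and
  from \<open>\<infinity>\<close>; the transverse curve reaches \<open>0\<close>.
\<close>

lemma boundary_arc: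
  fixes d0 d1 d2 :: real
  assumes "(0 < d2 \<and> d2 < d1 \<and> d1 < d0) \<or> (d1 < 0 \<and> 0 < d2 \<and> d2 < d0)"
  obtains I where "infinite I"
    "\<And>u. u \<in> I \<Longrightarrow> (u\<^sup>2 * (d0 - d2) - d2) / (d1 - d2) \<ge> 0"
    "\<And>u. u \<in> I \<Longrightarrow> (u\<^sup>2 * (d0 - d1) - d1) / (d2 - d1) \<ge> 0"
  using assms
proof
  assume *: "0 < d2 \<and> d2 < d1 \<and> d1 < d0"
  define l h where "l = sqrt (d2 / (d0 - d2))" and "h = sqrt (d1 / (d0 - d1))"
  have "d2 * d0 < d1 * d0" using * by (intro mult_strict_right_mono) auto
  then have "d2 / (d0 - d2) < d1 / (d0 - d1)"
    using * by (simp add: divide_less_eq less_divide_eq field_simps)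
  then have lh: "l < h" by (simp add: l_def h_def)
  have l: "0 \<le> l" "l\<^sup>2 = d2 / (d0 - d2)" and h: "0 \<le> h" "h\<^sup>2 = d1 / (d0 - d1)"
    using * by (simp_all add: l_def h_def)
  show thesis
  proof (rule that[of "{l<..<h}"])
    show "infinite {l<..<h}" using lh by simp
    fix u assume u: "u \<in> {l<..<h}"
    have "l\<^sup>2 < u\<^sup>2" using u l by (intro power_strict_mono) auto
    then have "u\<^sup>2 * (d0 - d2) - d2 > 0" using * by (simp add: l divide_less_eq)
    then show "(u\<^sup>2 * (d0 - d2) - d2) / (d1 - d2) \<ge> 0" using * by simp
    have "u\<^sup>2 < h\<^sup>2" using u l by (intro power_strict_mono) auto
    then have "u\<^sup>2 * (d0 - d1) - d1 < 0" using * by (simp add: h less_divide_eq)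
    then show "(u\<^sup>2 * (d0 - d1) - d1) / (d2 - d1) \<ge> 0" using * by (intro divide_nonpos_neg) auto
  qed
next
  assume *: "d1 < 0 \<and> 0 < d2 \<and> d2 < d0"
  define h where "h = sqrt (d2 / (d0 - d2))"
  have h: "0 < h" "h\<^sup>2 = d2 / (d0 - d2)" using * by (simp_all add: h_def)
  show thesis
  proof (rule that[of "{0<..<h}"])
    show "infinite {0<..<h}" using h by simp
    fix u assume u: "u \<in> {0<..<h}"
    have "u\<^sup>2 < h\<^sup>2" using u by (intro power_strict_mono) auto
    then have "u\<^sup>2 * (d0 - d2) - d2 < 0" using * by (simp add: h less_divide_eq)
    then show "(u\<^sup>2 * (d0 - d2) - d2) / (d1 - d2) \<ge> 0" using * by (intro divide_nonpos_neg) auto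
    have "u\<^sup>2 * (d0 - d1) \<ge> 0" using * by simp
    then show "(u\<^sup>2 * (d0 - d1) - d1) / (d2 - d1) \<ge> 0" using * by (intro divide_nonneg_pos) linarith+
  qed
qed

theorem theorem5p8:
  fixes a0 a1 a2 r :: real
    and A :: "real^3^3" and D :: "(real^3) set"
    and p v :: "nat \<Rightarrow> real^3"
    and m :: nat
    and f :: "complex \<Rightarrow> complex" and E :: "nat \<Rightarrow> complex"
  assumes "A = diag3 a0 a1 a2"
    and "(0 < a0 \<and> a0 < a1 \<and> a1 < a2 \<and> D = collared_domain A) \<or>
         (a1 < 0 \<and> 0 < a0 \<and> a0 < a2 \<and> D = transverse_domain A)"
    and "light_like_trajectory A D p v"
    and "2 * m \<ge> 4"
    and "r > 0" and "f holomorphic_on ball 0 r"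
    and "\<And>X. X \<in> ball 0 r \<Longrightarrow>
           (f X)\<^sup>2 = of_real (sgn a1) * (X - of_real a0) * (X - of_real a1) * (X - of_real a2)"
    and "E = fps_nth (fps_expansion f 0)"
  shows "periodic_trajectory A p v (2 * m) \<longleftrightarrow>
         Determinant.det (Matrix.mat (m - 1) (m - 1) (\<lambda>(i, j). E (i + j + 3))) = 0"
proof -
  have nz: "a0 \<noteq> 0" "a1 \<noteq> 0" "a2 \<noteq> 0" using assms(2) by auto
  interpret light_like_billiard a0 a1 a2 D p v
    using nz assms(1-3)
    by unfold_locales (auto simp: collared_domain_def transverse_domain_def)
  obtain c y where y: "c \<noteq> 0" "fps_expansion f 0 = fps_const c * y" "fps_nth y 0 = 1"
      "y\<^sup>2 = fps_of_poly (cubic (1 / a0) (1 / a1) (1 / a2))"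
    using normalized_root_expansion[OF nz assms(5-7)] by blast
  obtain \<epsilon> where \<epsilon>: "null_direction \<epsilon> (p 0) (v 0)" "\<bar>\<epsilon>\<bar> = 1" "\<epsilon> * \<epsilon> = 1"
    using null_direction_light_like[OF p_unit v_tangent, of 0] by force
  obtain x k where x: "chord_path K \<epsilon> (2 * m) x" "x 0 = p 0" "x (2 * m) = p k"
    "reflections k = 2 * m \<or> reflections k = Suc (2 * m) \<and> light_like_tangent A (p k)"
    using trajectory_chord_path[OF \<epsilon>(1,2)] assms(1) by metis
  have "periodic_trajectory A p v (2 * m) \<longleftrightarrow> x (2 * m) = x 0"
    using periodic_iff[OF \<epsilon>(1,2) _ _ x(2,3)] x(4) assms(1,4) by simp
  also have "\<dots> \<longleftrightarrow> Determinant.det (Matrix.mat (m - 1) (m - 1) (\<lambda>(i, j). fps_nth y (i + j + 3))) = 0"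
  proof -
    have inv: "1 / a2 < 1 / a0" "1 / a0 \<noteq> 1 / a1" "1 / a1 \<noteq> 1 / a2" "0 < 1 / a2"
      using assms(2) by (auto simp: frac_less2)
    have order: "(0 < 1 / a2 \<and> 1 / a2 < 1 / a1 \<and> 1 / a1 < 1 / a0) \<or> (1 / a1 < 0 \<and> 0 < 1 / a2 \<and> 1 / a2 < 1 / a0)"
      using assms(2) by (auto simp: frac_less2)
    obtain I where I: "infinite I"
      "\<And>u. u \<in> I \<Longrightarrow> (u\<^sup>2 * (1 / a0 - 1 / a2) - 1 / a2) / (1 / a1 - 1 / a2) \<ge> 0"
      "\<And>u. u \<in> I \<Longrightarrow> (u\<^sup>2 * (1 / a0 - 1 / a1) - 1 / a1) / (1 / a2 - 1 / a1) \<ge> 0"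
      using boundary_arc[OF order] by blast
    show ?thesis
      by (rule chord_path_closes_iff_hankel[OF _ _ _ _ _ _ _ I y(4,3) \<epsilon>(3) x(1)])
        (use assms(4) nz inv in auto)
  qed
  also have "\<dots> \<longleftrightarrow> Determinant.det (Matrix.mat (m - 1) (m - 1) (\<lambda>(i, j). E (i + j + 3))) = 0"
    unfolding assms(8) y(2) by (rule hankel_det_scale[OF y(1), symmetric])
  finally show ?thesis .
qed

end
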